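(* Let $G$ be a torsion-free non-elementary word-hyperbolic group with a marked finite generating set $A$, let $H\le G$ be a quasiconvex subgroup, and let $Y=\Gamma(G/H,A)$ be the relative Cayley graph. Then the simple random walk on $Y$ is transient if and only if $[G:H]=\infty$.
   Context: A marked finite generating set of $G$ is a map $\pi:A\to G$ from a finite alphabet $A$ such that $\pi(A)$ generates $G$. The relative Cayley graph $\Gamma(G/H,A)$ has vertex set the right cosets $Hg$ ($g\in G$) and, for each $(Hg,a)\in G/H\times A$, an edge from $Hg$ to $Hg\pi(a)$ labeled $a$; it is a connected $2|A|$-regular graph. A connected graph of bounded degree is recurrent if the simple random walk returns to the base point with probability 1, and transient otherwise. $H$ quasiconvex means there is $C>0$ such that every geodesic in the Cayley graph $\Gamma(G,A)$ with endpoints in $H$ lies in the $C$-neighborhood of $H$. Non-elementary means not virtually cyclic. *)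

theory Defs
  imports "HOL-Algebra.Algebra" "HOL-Analysis.Analysis"
begin

text \<open>Marked finite generating set: alphabet A (finite set), marking pi.
  A step of the Cayley graph is a letter together with an orientation:
  (a, True) means right multiplication by pi a (following the edge labelled a forwards),
  (a, False) means right multiplication by inv (pi a) (following it backwards).\<close>

definition gen_step :: "('g, 'm) monoid_scheme \<Rightarrow> ('a \<Rightarrow> 'g) \<Rightarrow> 'a \<times> bool \<Rightarrow> 'g" where
  "gen_step G \<pi> s = (if snd s then \<pi> (fst s) else inv\<^bsub>G\<^esub> (\<pi> (fst s)))"

definition word_dist :: "('g, 'm) monoid_scheme \<Rightarrow> ('a \<Rightarrow> 'g) \<Rightarrow> 'a set \<Rightarrow> 'g \<Rightarrow> 'g \<Rightarrow> nat" where
  "word_dist G \<pi> A g h =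
     (LEAST n. \<exists>w. set w \<subseteq> A \<times> UNIV \<and> length w = n \<and>
        h = foldl (\<lambda>x s. x \<otimes>\<^bsub>G\<^esub> gen_step G \<pi> s) g w)"

definition gromov_product :: "('g, 'm) monoid_scheme \<Rightarrow> ('a \<Rightarrow> 'g) \<Rightarrow> 'a set \<Rightarrow> 'g \<Rightarrow> 'g \<Rightarrow> 'g \<Rightarrow> real" where
  "gromov_product G \<pi> A w x y =
     (real (word_dist G \<pi> A x w) + real (word_dist G \<pi> A y w) - real (word_dist G \<pi> A x y)) / 2"

definition word_hyperbolic :: "('g, 'm) monoid_scheme \<Rightarrow> ('a \<Rightarrow> 'g) \<Rightarrow> 'a set \<Rightarrow> bool" where
  "word_hyperbolic G \<pi> A \<longleftrightarrow>
     (\<exists>\<delta>::real. \<delta> \<ge> 0 \<and> (\<forall>w\<in>carrier G. \<forall>x\<in>carrier G. \<forall>y\<in>carrier G. \<forall>z\<in>carrier G.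
        gromov_product G \<pi> A w x z \<ge>
          min (gromov_product G \<pi> A w x y) (gromov_product G \<pi> A w y z) - \<delta>))"

definition torsion_free :: "('g, 'm) monoid_scheme \<Rightarrow> bool" where
  "torsion_free G \<longleftrightarrow>
     (\<forall>g\<in>carrier G. g \<noteq> \<one>\<^bsub>G\<^esub> \<longrightarrow> (\<forall>n::nat. n > 0 \<longrightarrow> g [^]\<^bsub>G\<^esub> n \<noteq> \<one>\<^bsub>G\<^esub>))"

definition virtually_cyclic :: "('g, 'm) monoid_scheme \<Rightarrow> bool" where
  "virtually_cyclic G \<longleftrightarrow> (\<exists>g\<in>carrier G. finite (rcosets\<^bsub>G\<^esub> (generate G {g})))"

definition cayley_geodesic :: "('g, 'm) monoid_scheme \<Rightarrow> ('a \<Rightarrow> 'g) \<Rightarrow> 'a set \<Rightarrow> 'g list \<Rightarrow> bool" where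
  "cayley_geodesic G \<pi> A xs \<longleftrightarrow>
     xs \<noteq> [] \<and> set xs \<subseteq> carrier G \<and>
     (\<forall>i. Suc i < length xs \<longrightarrow>
        (\<exists>s\<in>A \<times> UNIV. xs ! Suc i = xs ! i \<otimes>\<^bsub>G\<^esub> gen_step G \<pi> s)) \<and>
     length xs - 1 = word_dist G \<pi> A (hd xs) (last xs)"

definition quasiconvex :: "('g, 'm) monoid_scheme \<Rightarrow> ('a \<Rightarrow> 'g) \<Rightarrow> 'a set \<Rightarrow> 'g set \<Rightarrow> bool" where
  "quasiconvex G \<pi> A H \<longleftrightarrow>
     (\<exists>C::real. C > 0 \<and> (\<forall>xs. cayley_geodesic G \<pi> A xs \<and> hd xs \<in> H \<and> last xs \<in> H \<longrightarrow>
        (\<forall>x\<in>set xs. \<exists>h\<in>H. real (word_dist G \<pi> A x h) \<le> C)))"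

text \<open>Simple random walk on the relative Cayley graph Gamma(G/H, A) (vertices: right cosets
  H g; from each vertex there are 2|A| half-edges, one per step in A x bool, each taken with
  probability 1/(2|A|)).  first_hit n C = probability that the walk started at C first visits
  the base vertex H at time exactly n.\<close>
fun first_hit :: "('g, 'm) monoid_scheme \<Rightarrow> ('a \<Rightarrow> 'g) \<Rightarrow> 'a set \<Rightarrow> 'g set \<Rightarrow> nat \<Rightarrow> 'g set \<Rightarrow> real" where
  "first_hit G \<pi> A H 0 C = (if C = H then 1 else 0)"
| "first_hit G \<pi> A H (Suc n) C =
     (if C = H then 0
      else (\<Sum>s\<in>A \<times> UNIV. first_hit G \<pi> A H n (C #>\<^bsub>G\<^esub> gen_step G \<pi> s)) / (2 * real (card A)))"

text \<open>Probability that the walk started at the base vertex H first returns to H at time n+1.\<close>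
definition first_return :: "('g, 'm) monoid_scheme \<Rightarrow> ('a \<Rightarrow> 'g) \<Rightarrow> 'a set \<Rightarrow> 'g set \<Rightarrow> nat \<Rightarrow> real" where
  "first_return G \<pi> A H n =
     (\<Sum>s\<in>A \<times> UNIV. first_hit G \<pi> A H n (H #>\<^bsub>G\<^esub> gen_step G \<pi> s)) / (2 * real (card A))"

definition srw_recurrent :: "('g, 'm) monoid_scheme \<Rightarrow> ('a \<Rightarrow> 'g) \<Rightarrow> 'a set \<Rightarrow> 'g set \<Rightarrow> bool" where
  "srw_recurrent G \<pi> A H \<longleftrightarrow> (first_return G \<pi> A H sums 1)"

definition srw_transient :: "('g, 'm) monoid_scheme \<Rightarrow> ('a \<Rightarrow> 'g) \<Rightarrow> 'a set \<Rightarrow> 'g set \<Rightarrow> bool" where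
  "srw_transient G \<pi> A H \<longleftrightarrow> \<not> srw_recurrent G \<pi> A H"

end

theory Submission
  imports Defs
begin

text \<open>If the index is finite, the probability of never hitting \<open>H\<close> is harmonic off \<open>H\<close> and vanishes
  at \<open>H\<close>, so it is zero by the maximum principle.

  If the index is infinite, we map a binary tree into the coset graph with bounded edge lengths and
  with bounded fibres on each level; then Cauchy-Schwarz along the levels bounds \<open>f H\<close> by a multiple
  of the square root of the Dirichlet energy of any finitely supported \<open>f\<close>. For the truncated Green
  function at \<open>H\<close> the energy is at most a multiple of \<open>f H\<close> itself, so the Green function is finite
  and the renewal equation excludes recurrence.

  The tree is \<open>w \<mapsto> H g w\<close> for positive words \<open>w\<close> in two elements. A hyperbolic element \<open>c\<close> comes from
  the midpoint of a long geodesic. Since \<open>G\<close> is not virtually cyclic, some \<open>g'\<close> is far from the powers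
  of \<open>c\<close>, and then \<open>t\<close> and \<open>g' t\<close>, for \<open>t\<close> a high positive or negative power of \<open>c\<close>, generate a free
  semigroup whose words do not backtrack. Quasiconvexity gives long \<open>g\<close> making a bounded Gromov
  product with all of \<open>H\<close>; words that do not backtrack along \<open>g\<close> keep \<open>g w\<close> away from \<open>H\<close>, so
  that \<open>H g w = H g v\<close> forces \<open>g w = h g v\<close> with \<open>h\<close> in a fixed ball.\<close>

section \<open>Hyperbolic length functions\<close>

text \<open>A left-invariant metric is recorded by the distance to \<open>\<one>\<close>: the
  distance of \<open>x\<close> and \<open>y\<close> is \<open>len (inv x \<otimes> y)\<close>. Then
  \<open>split_len\<close> cuts a geodesic at an integer point, and changing the base point amounts
  to a translation.\<close>

locale hyperbolic_length = group G for G (structure) +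
  fixes len :: "'a \<Rightarrow> real" and \<delta> :: real
  assumes len_one: "len \<one> = 0"
    and len_inv: "x \<in> carrier G \<Longrightarrow> len (inv x) = len x"
    and len_mult: "\<lbrakk>x \<in> carrier G; y \<in> carrier G\<rbrakk> \<Longrightarrow> len (x \<otimes> y) \<le> len x + len y"
    and finite_ball: "finite {x \<in> carrier G. len x \<le> r}"
    and split_len: "\<lbrakk>x \<in> carrier G; real n \<le> len x\<rbrakk> \<Longrightarrow>
        \<exists>u\<in>carrier G. \<exists>v\<in>carrier G. x = u \<otimes> v \<and> len u = real n \<and> len v = len x - real n"
    and four_point: "\<lbrakk>x \<in> carrier G; y \<in> carrier G; z \<in> carrier G\<rbrakk> \<Longrightarrow>
        min ((len x + len y - len (inv x \<otimes> y)) / 2) ((len y + len z - len (inv y \<otimes> z)) / 2) - \<delta>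
          \<le> (len x + len z - len (inv x \<otimes> z)) / 2"
begin

text \<open>The Gromov product at base point \<open>\<one>\<close>: up to a bounded error, how long
  geodesics from \<open>\<one>\<close> to \<open>x\<close> and \<open>y\<close> run
  together.\<close>

definition gp :: "'a \<Rightarrow> 'a \<Rightarrow> real" where
  "gp x y = (len x + len y - len (inv x \<otimes> y)) / 2"

lemma inv_mult_cancel:
  assumes "x \<in> carrier G" "y \<in> carrier G"
  shows "inv x \<otimes> (x \<otimes> y) = y" "x \<otimes> (inv x \<otimes> y) = y"
  using assms by (simp_all add: m_assoc[symmetric])

lemma len_nonneg: "x \<in> carrier G \<Longrightarrow> 0 \<le> len x"
  using len_mult[of x "inv x"] len_inv[of x] len_one by simp

lemma len_inv_mult_sym:
  assumes "x \<in> carrier G" "y \<in> carrier G"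
  shows "len (inv x \<otimes> y) = len (inv y \<otimes> x)"
  using len_inv[of "inv x \<otimes> y"] assms by (simp add: inv_mult_group)

lemma len_triangle:
  assumes "x \<in> carrier G" "y \<in> carrier G" "z \<in> carrier G"
  shows "len (inv x \<otimes> z) \<le> len (inv x \<otimes> y) + len (inv y \<otimes> z)"
proof -
  have "inv x \<otimes> z = (inv x \<otimes> y) \<otimes> (inv y \<otimes> z)"
    using assms by (simp add: m_assoc inv_mult_cancel)
  then show ?thesis using len_mult assms by simp
qed

lemma gp_sym: "\<lbrakk>x \<in> carrier G; y \<in> carrier G\<rbrakk> \<Longrightarrow> gp x y = gp y x"
  unfolding gp_def using len_inv_mult_sym by simp

lemma gp_four: "\<lbrakk>x \<in> carrier G; y \<in> carrier G; z \<in> carrier G\<rbrakk> \<Longrightarrow>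
    min (gp x y) (gp y z) - \<delta> \<le> gp x z"
  unfolding gp_def by (rule four_point)

lemma gp_same: "x \<in> carrier G \<Longrightarrow> gp x x = len x"
  by (simp add: gp_def len_one)

lemma gp_one: "x \<in> carrier G \<Longrightarrow> gp \<one> x = 0" "x \<in> carrier G \<Longrightarrow> gp x \<one> = 0"
  by (simp_all add: gp_def len_one len_inv)

lemma delta_nonneg: "0 \<le> \<delta>"
  using gp_four[of \<one> \<one> \<one>] by (simp add: gp_one)

lemma gp_le_len: "\<lbrakk>x \<in> carrier G; y \<in> carrier G\<rbrakk> \<Longrightarrow> gp x y \<le> len x"
  unfolding gp_def using len_mult[of x "inv x \<otimes> y"] by (simp add: inv_mult_cancel)

lemma gp_lip: "\<lbrakk>x \<in> carrier G; y \<in> carrier G; z \<in> carrier G\<rbrakk> \<Longrightarrow>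
    gp x z \<le> gp y z + len (inv x \<otimes> y)"
  unfolding gp_def
  using len_mult[of y "inv y \<otimes> x"] len_triangle[of y x z] len_inv_mult_sym[of x y]
  by (simp add: inv_mult_cancel field_simps)

text \<open>In the triangle \<open>\<one>\<close>, \<open>g\<close>, \<open>g \<otimes> w\<close>,
  the Gromov products at the two ends of the side from \<open>\<one>\<close> to \<open>g\<close> add
  up to its length. So \<open>g \<otimes> w\<close> starts like \<open>g\<close> unless
  \<open>w\<close> starts like \<open>inv g\<close>.\<close>

lemma gp_mult_left:
  assumes "g \<in> carrier G" "w \<in> carrier G"
  shows "gp (g \<otimes> w) g = len g - gp w (inv g)"
proof -
  have "inv w \<otimes> inv g = inv (g \<otimes> w)" using assms by (simp add: inv_mult_group)
  then have "len (inv w \<otimes> inv g) = len (g \<otimes> w)" using assms len_inv by simp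
  moreover have "inv (g \<otimes> w) \<otimes> g = inv w" using assms by (simp add: inv_mult_group m_assoc)
  ultimately show ?thesis using assms by (simp add: gp_def len_inv field_simps)
qed

text \<open>The right side is the product of \<open>x\<close> and \<open>y\<close> seen from
  \<open>g\<close>; moving the base point costs at most \<open>len g\<close>.\<close>

lemma gp_translate_lower:
  assumes "g \<in> carrier G" "x \<in> carrier G" "y \<in> carrier G"
  shows "gp x y - len g \<le> gp (inv g \<otimes> x) (inv g \<otimes> y)"
proof -
  have "inv (inv g \<otimes> x) \<otimes> (inv g \<otimes> y) = inv x \<otimes> y"
    using assms by (simp add: inv_mult_group m_assoc inv_mult_cancel)
  then show ?thesis
    using len_mult[of g "inv g \<otimes> x"] len_mult[of g "inv g \<otimes> y"] assms
    by (simp add: gp_def inv_mult_cancel field_simps)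
qed

text \<open>A coarse path comes as close to the base point as the Gromov product of its ends predicts,
  up to its failure to be geodesic: take the first point where the Gromov products with
  the two ends switch order.\<close>

lemma path_near_base:
  fixes x :: "nat \<Rightarrow> 'a"
  assumes x: "\<And>i. i \<le> k \<Longrightarrow> x i \<in> carrier G"
    and step: "\<And>i. i < k \<Longrightarrow> len (inv (x i) \<otimes> x (Suc i)) \<le> s"
    and s: "0 \<le> s"
  shows "\<exists>i\<le>k. len (x i) \<le> gp (x 0) (x k) + 2 * \<delta> + s
           + gp (inv (x i) \<otimes> x 0) (inv (x i) \<otimes> x k)"
proof -
  let ?P = "\<lambda>i. i \<le> k \<and> gp (x 0) (x i) \<le> gp (x i) (x k)"
  have "?P k" using gp_le_len[of "x k" "x 0"] gp_sym[of "x k" "x 0"] x by (simp add: gp_same)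
  define i where "i = (LEAST i. ?P i)"
  have Pi: "?P i" unfolding i_def by (rule LeastI[of ?P k]) fact
  have ik: "i \<le> k" using Pi by simp
  have 1: "gp (x 0) (x i) \<le> gp (x 0) (x k) + \<delta>"
    using gp_four[of "x 0" "x i" "x k"] Pi x by simp
  have 2: "gp (x i) (x k) \<le> gp (x 0) (x k) + \<delta> + s"
  proof (cases i)
    case 0
    then show ?thesis using s delta_nonneg by simp
  next
    case (Suc j)
    then have "\<not> ?P j" unfolding i_def by (intro not_less_Least) simp
    with Suc ik have "gp (x j) (x k) \<le> gp (x 0) (x j)" "j < k" by auto
    then have "gp (x j) (x k) \<le> gp (x 0) (x k) + \<delta>"
      using gp_four[of "x 0" "x j" "x k"] x by simp
    moreover have "gp (x i) (x k) \<le> gp (x j) (x k) + s"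
      using gp_lip[of "x i" "x j" "x k"] step[of j] x Suc \<open>j < k\<close>
        len_inv_mult_sym[of "x i" "x j"] by simp
    ultimately show ?thesis by simp
  qed
  \<comment> \<open>The products of \<open>x i\<close> with the two ends add up to
    \<open>len (x i)\<close>, corrected by the products of the two ends seen from
    \<open>\<one>\<close> and from \<open>x i\<close>.\<close>
  have "inv (inv (x i) \<otimes> x 0) \<otimes> (inv (x i) \<otimes> x k) = inv (x 0) \<otimes> x k"
    using x ik by (simp add: inv_mult_group m_assoc inv_mult_cancel)
  then have "gp (x 0) (x i) + gp (x i) (x k)
      = len (x i) + gp (x 0) (x k) - gp (inv (x i) \<otimes> x 0) (inv (x i) \<otimes> x k)"
    unfolding gp_def using len_inv_mult_sym[of "x 0" "x i"] x ik by (simp add: field_simps)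
  with 1 2 ik show ?thesis by (intro exI[of _ i]) auto
qed

section \<open>Positive words with little cancellation\<close>

definition lprod :: "'a list \<Rightarrow> 'a" where
  "lprod w = foldr (\<otimes>) w \<one>"

lemma lprod_simps [simp]: "lprod [] = \<one>" "lprod (x # w) = x \<otimes> lprod w"
  by (simp_all add: lprod_def)

lemma lprod_closed [simp]: "set w \<subseteq> carrier G \<Longrightarrow> lprod w \<in> carrier G"
  by (induction w) auto

lemma lprod_append:
  "\<lbrakk>set v \<subseteq> carrier G; set w \<subseteq> carrier G\<rbrakk> \<Longrightarrow> lprod (v @ w) = lprod v \<otimes> lprod w"
  by (induction v) (auto simp: m_assoc)

lemma lprod_map_inv:
  "set w \<subseteq> carrier G \<Longrightarrow> lprod (map (m_inv G) w) = inv (lprod (rev w))"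
  by (induction w) (auto simp: lprod_append inv_mult_group)

text \<open>The length bound lets each letter survive the cancellation at both of its ends. Letters
  may still start alike; this is excluded separately where words must be told apart.\<close>

definition schottky :: "'a set \<Rightarrow> real \<Rightarrow> bool" where
  "schottky S L \<longleftrightarrow> S \<subseteq> carrier G \<and> 0 \<le> L \<and> (\<forall>x\<in>S. \<forall>y\<in>S. gp (inv x) y \<le> L) \<and>
     (\<forall>x\<in>S. 2 * L + 4 * \<delta> < len x)"

text \<open>By induction \<open>y \<otimes> lprod w\<close> shares with \<open>y\<close> a start
  longer than \<open>L + 3 * \<delta>\<close>, so it diverges from \<open>inv x\<close> as
  \<open>y\<close> does, up to a single \<open>\<delta>\<close>. The error does not
  accumulate.\<close>

lemma schottky_letter_word:
  assumes S: "schottky S L" and "set w \<subseteq> S" "x \<in> S"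
  shows "gp (inv x) (lprod w) \<le> L + \<delta>"
  using assms(2,3)
proof (induction w arbitrary: x)
  case Nil
  then show ?case using S delta_nonneg by (auto simp: schottky_def gp_one)
next
  case (Cons y w)
  have c: "x \<in> carrier G" "y \<in> carrier G" "set w \<subseteq> carrier G" "lprod w \<in> carrier G"
    using Cons.prems S by (auto simp: schottky_def)
  have "gp (inv y) (lprod w) \<le> L + \<delta>" using Cons by simp
  then have "len y - L - \<delta> \<le> gp (y \<otimes> lprod w) y"
    using gp_mult_left[of y "lprod w"] gp_sym[of "inv y" "lprod w"] c by simp
  moreover have "gp (inv x) y \<le> L" "2 * L + 4 * \<delta> < len y"
    using Cons.prems S by (auto simp: schottky_def)
  ultimately show ?case
    using gp_four[of "inv x" "y \<otimes> lprod w" y] c delta_nonneg by (simp add: min_def split: if_splits)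
qed

text \<open>The inverse of a word starts like the inverse of its last letter, and for that
  \<open>schottky_letter_word\<close> gives the bound.\<close>

lemma schottky_word_word:
  assumes S: "schottky S L" and v: "set v \<subseteq> S" and w: "set w \<subseteq> S"
  shows "gp (inv (lprod v)) (lprod w) \<le> L + 2 * \<delta>"
  using v w
proof (induction v arbitrary: w rule: rev_induct)
  case Nil
  then have "set w \<subseteq> carrier G" using S by (auto simp: schottky_def)
  then show ?case using S delta_nonneg by (auto simp: schottky_def gp_one)
next
  case (snoc x v)
  have x: "x \<in> S" using snoc.prems by simp
  have c: "x \<in> carrier G" "set v \<subseteq> carrier G" "lprod v \<in> carrier G" "lprod w \<in> carrier G"
    using snoc.prems S by (auto simp: schottky_def intro!: lprod_closed)
  \<comment> \<open>The induction hypothesis for the one-letter word \<open>[x]\<close> bounds the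
    cancellation inside \<open>v @ [x]\<close>.\<close>
  have "gp (inv (lprod v)) x \<le> L + 2 * \<delta>" using snoc.IH[of "[x]"] snoc.prems c by simp
  moreover have e: "inv (lprod (v @ [x])) = inv x \<otimes> inv (lprod v)"
    using c by (simp add: lprod_append inv_mult_group)
  ultimately have "len x - L - 2 * \<delta> \<le> gp (inv x) (inv (lprod (v @ [x])))"
    using gp_mult_left[of "inv x" "inv (lprod v)"] c len_inv[of x]
      gp_sym[of "inv x" "inv x \<otimes> inv (lprod v)"] by simp
  moreover have "gp (inv x) (lprod w) \<le> L + \<delta>"
    using schottky_letter_word[OF S _ x] snoc.prems by simp
  moreover have "2 * L + 4 * \<delta> < len x" using x S by (auto simp: schottky_def)
  ultimately show ?case
    using gp_four[of "inv x" "inv (lprod (v @ [x]))" "lprod w"] c e delta_nonneg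
    by (simp add: min_def split: if_splits)
qed

text \<open>A product shares more than \<open>L + 3 * \<delta>\<close> with its first letter, so it
  determines this letter once the two letters diverge by \<open>L\<close>. Cancel it and go
  on.\<close>

lemma schottky_distinct:
  assumes S: "schottky S L" and E: "range E \<subseteq> S" and sep: "gp (E True) (E False) \<le> L"
    and len: "length v = length w" and eq: "lprod (map E v) = lprod (map E w)"
  shows "v = w"
  using len eq
proof (induction v w rule: list_induct2)
  case Nil
  show ?case by simp
next
  case (Cons a v b w)
  have EC: "E i \<in> carrier G" "E i \<in> S" for i using E S by (auto simp: schottky_def)
  have c: "lprod (map E u) \<in> carrier G" for u using EC by (intro lprod_closed) auto
  have near: "len (E i) - L - \<delta> \<le> gp (E i \<otimes> lprod (map E u)) (E i)" for i u
    using schottky_letter_word[OF S, of "map E u" "E i"] gp_mult_left[of "E i" "lprod (map E u)"]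
      gp_sym[of "inv (E i)" "lprod (map E u)"] EC c by (simp add: image_subset_iff)
  have big: "2 * L + 4 * \<delta> < len (E i)" for i using S EC by (auto simp: schottky_def)
  have "a = b"
  proof (rule ccontr)
    assume "a \<noteq> b"
    then have s: "gp (E a) (E b) \<le> L"
      using sep gp_sym[of "E True" "E False"] EC by (cases a; cases b) auto
    define z where "z = E a \<otimes> lprod (map E v)"
    have z: "z \<in> carrier G" "z = E b \<otimes> lprod (map E w)"
      using Cons.prems EC c by (auto simp: z_def)
    have "len (E a) - L - \<delta> \<le> gp (E a) z" "len (E b) - L - \<delta> \<le> gp z (E b)"
      using near[of a v] near[of b w] gp_sym[of "E a" z] EC z by (auto simp: z_def[symmetric])
    then show False using gp_four[of "E a" z "E b"] s big[of a] big[of b] EC z delta_nonneg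
      by (simp add: min_def split: if_splits)
  qed
  moreover have "lprod (map E v) = lprod (map E w)"
    using Cons.prems \<open>a = b\<close> EC c by simp
  ultimately show ?case using Cons.IH by simp
qed

text \<open>Two opposite directions \<open>x\<close>, \<open>y\<close> are read off the midpoint of a long geodesic; if neither
  is itself hyperbolic, then \<open>x \<otimes> y\<close> starts like \<open>x\<close> and ends like \<open>y\<close>.\<close>

lemma exists_hyperbolic_element:
  assumes inf: "infinite (carrier G)"
  shows "\<exists>c\<in>carrier G. R \<le> len c \<and> gp (inv c) c \<le> 3 * \<delta>"
proof -
  obtain n :: nat where n: "R + 5 * \<delta> + 1 \<le> real n" "5 * \<delta> + 1 \<le> real n"
    using real_arch_simple[of "max (R + 5 * \<delta> + 1) (5 * \<delta> + 1)"] by auto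
  have "\<not> carrier G \<subseteq> {x \<in> carrier G. len x \<le> 2 * real n}"
    using finite_ball inf finite_subset by blast
  then obtain k where k: "k \<in> carrier G" "2 * real n < len k" by force
  then have "real n \<le> len k" by simp
  from split_len[OF k(1) this] obtain m y where
    m: "m \<in> carrier G" "y \<in> carrier G" "k = m \<otimes> y" "len m = real n" "len y = len k - real n"
    by blast
  \<comment> \<open>Seen from \<open>m\<close>, the ends \<open>\<one>\<close> and \<open>k\<close>
    of the geodesic are \<open>inv m\<close> and \<open>y\<close>. Their Gromov product vanishes
    because \<open>m\<close> lies between them.\<close>
  define x where "x = inv m"
  have x: "x \<in> carrier G" "len x = real n" "len y \<ge> real n" "y \<in> carrier G"
    using m k by (auto simp: x_def len_inv)
  have xy: "gp x y = 0" using m by (simp add: gp_def x_def len_inv)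
  note d = delta_nonneg
  show ?thesis
  proof (cases "gp (inv x) x \<le> 2 * \<delta> \<or> gp (inv y) y \<le> 2 * \<delta>")
    case True
    then show ?thesis
    proof
      assume "gp (inv x) x \<le> 2 * \<delta>"
      then show ?thesis using x n d by (intro bexI[of _ x]) auto
    next
      assume "gp (inv y) y \<le> 2 * \<delta>"
      then show ?thesis using x n d by (intro bexI[of _ y]) auto
    qed
  next
    case False
    define c where "c = x \<otimes> y"
    have c: "c \<in> carrier G" "inv c = inv y \<otimes> inv x" using x by (auto simp: c_def inv_mult_group)
    \<comment> \<open>By \<open>False\<close>, \<open>inv x\<close> starts like \<open>x\<close> and
      inherits its divergence from \<open>y\<close>; likewise \<open>inv y\<close> inherits that of
      \<open>y\<close> from \<open>x\<close>.\<close>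
    have 1: "gp (inv x) y \<le> \<delta>"
      using gp_four[of x "inv x" y] xy False x gp_sym[of x "inv x"] d
      by (simp add: min_def split: if_splits)
    have 2: "gp x (inv y) \<le> \<delta>"
      using gp_four[of x "inv y" y] xy False x d by (simp add: min_def split: if_splits)
    have 3: "real n - \<delta> \<le> gp c x"
      using gp_mult_left[of x y] gp_sym[of y "inv x"] 1 x by (simp add: c_def)
    have 4: "real n - \<delta> \<le> gp (inv c) (inv y)"
      using gp_mult_left[of "inv y" "inv x"] 1 x c by (simp add: len_inv)
    have 5: "gp c (inv y) \<le> 2 * \<delta>"
      using gp_four[of x c "inv y"] 2 3 gp_sym[of x c] x c(1) n d
      by (simp add: min_def split: if_splits)
    have 6: "gp (inv c) c \<le> 3 * \<delta>"
      using gp_four[of c "inv c" "inv y"] 4 5 gp_sym[of c "inv c"] x c(1) n d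
      by (simp add: min_def split: if_splits)
    have "len c = len x + len y - 2 * gp (inv x) y"
      using x by (simp add: gp_def c_def len_inv field_simps)
    then have "R \<le> len c" using 1 x n d by simp
    then show ?thesis using 6 c by blast
  qed
qed

text \<open>Otherwise every right coset of \<open>K\<close> meets one fixed ball, and balls are
  finite.\<close>

lemma exists_far_from_subgroup:
  assumes K: "subgroup K G" and inf: "infinite (rcosets K)"
  shows "\<exists>g\<in>carrier G. \<forall>k\<in>K. r < len (k \<otimes> g)"
proof (rule ccontr)
  assume "\<not> ?thesis"
  then have near: "\<exists>k\<in>K. len (k \<otimes> g) \<le> r" if "g \<in> carrier G" for g using that by force
  have KG: "K \<subseteq> carrier G" using K by (rule subgroup.subset)
  have "rcosets K \<subseteq> (\<lambda>x. K #> x) ` {x \<in> carrier G. len x \<le> r}"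
  proof
    fix C assume "C \<in> rcosets K"
    then obtain g where g: "g \<in> carrier G" "C = K #> g" by (auto simp: RCOSETS_def)
    obtain k where k: "k \<in> K" "len (k \<otimes> g) \<le> r" using near g by blast
    have "K #> (k \<otimes> g) = C"
      using k g KG K coset_mult_assoc[of K k g] coset_join2[of k K] by auto
    then show "C \<in> (\<lambda>x. K #> x) ` {x \<in> carrier G. len x \<le> r}" using k g KG by blast
  qed
  then show False using inf finite_ball finite_surj by blast
qed

section \<open>Powers of a hyperbolic element and ping-pong\<close>

lemma inv_int_pow_mult:
  assumes "c \<in> carrier G"
  shows "inv (c [^] (i::int)) \<otimes> c [^] (j::int) = c [^] (j - i)"
  using int_pow_mult[of c "- i" j] assms by (simp add: int_pow_neg)

text \<open>Powers of \<open>c\<close> are words over the one-letter alphabet \<open>{c}\<close>.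
  They trace a coarse axis, on which \<open>\<one>\<close> lies between negative and positive
  powers.\<close>

lemma schottky_pow:
  assumes S: "schottky {c} L" and n: "0 \<le> m" "0 \<le> n"
  shows "gp (c [^] (- m :: int)) (c [^] (n :: int)) \<le> L + 2 * \<delta>"
proof -
  have c: "c \<in> carrier G" using S by (simp add: schottky_def)
  have sr: "set (replicate k c) \<subseteq> {c}" for k by auto
  have r: "lprod (replicate k c) = c [^] int k" for k
  proof (induction k)
    case (Suc k)
    then show ?case using c int_pow_mult[OF c, of 1 "int k"] by (simp add: add.commute)
  qed simp
  show ?thesis
    using schottky_word_word[OF S sr sr, of "nat m" "nat n"] n c
    by (simp add: r int_pow_neg)
qed

text \<open>Each further factor adds \<open>len c\<close> and cancels at most
  \<open>2 * (L + 2 * \<delta>)\<close>, a net gain of at least one.\<close>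

lemma schottky_pow_len:
  assumes S: "schottky {c} L" and big: "2 * L + 4 * \<delta> + 1 \<le> len c"
  shows "real n \<le> len (c [^] int n)"
proof (induction n)
  case 0
  then show ?case using len_one by simp
next
  case (Suc n)
  have c: "c \<in> carrier G" using S by (simp add: schottky_def)
  have e: "c [^] int (Suc n) = c \<otimes> c [^] int n"
    using c int_pow_mult[OF c, of 1 "int n"] by (simp add: add.commute)
  have "gp (inv c) (c [^] int n) \<le> L + 2 * \<delta>"
    using schottky_pow[OF S, of 1 "int n"] c by (simp add: int_pow_neg)
  moreover have "len (c \<otimes> c [^] int n) = len c + len (c [^] int n) - 2 * gp (inv c) (c [^] int n)"
    using c by (simp add: gp_def len_inv field_simps)
  ultimately show ?case using Suc big e by simp
qed

text \<open>Suppose for both choices of \<open>t\<close> that \<open>g \<otimes> t\<close> runs far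
  along some \<open>u\<close>. Then two points of the axis translated by \<open>inv g\<close> follow
  opposite ends of the axis of \<open>c\<close>, so they diverge, and the translated axis comes near
  \<open>\<one>\<close>, contrary to \<open>far\<close>.\<close>

lemma exists_transverse_power:
  assumes c: "schottky {c} L" and g: "g \<in> carrier G"
    and far: "\<And>k::int. 2 * L + 8 * \<delta> + len c < len (inv g \<otimes> c [^] k)"
  shows "\<exists>t\<in>{c [^] int n, c [^] (- int n)}.
    \<forall>u\<in>{c [^] int n, c [^] (- int n)}. gp (g \<otimes> t) u \<le> L + 4 * \<delta> + len g"
proof (rule ccontr)
  assume neg: "\<not> ?thesis"
  define m where "m = int n"
  have cc: "c \<in> carrier G" "0 \<le> L" using c by (auto simp: schottky_def)
  have "\<exists>u\<in>{c [^] m, c [^] (- m)}. L + 4 * \<delta> < gp t (inv g \<otimes> u)"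
    if t: "t \<in> {c [^] m, c [^] (- m)}" for t
  proof -
    obtain u where u: "u \<in> {c [^] m, c [^] (- m)}" "L + 4 * \<delta> + len g < gp (g \<otimes> t) u"
      using neg t unfolding m_def by force
    have tc: "t \<in> carrier G" "u \<in> carrier G" using t u cc by auto
    then have "L + 4 * \<delta> < gp t (inv g \<otimes> u)"
      using gp_translate_lower[of g "g \<otimes> t" u] u(2) g by (simp add: inv_mult_cancel)
    then show ?thesis using u by blast
  qed
  then obtain u v where u: "u \<in> {c [^] m, c [^] (- m)}" "L + 4 * \<delta> < gp (c [^] m) (inv g \<otimes> u)"
    and v: "v \<in> {c [^] m, c [^] (- m)}" "L + 4 * \<delta> < gp (c [^] (- m)) (inv g \<otimes> v)" by blast
  have uvc: "u \<in> carrier G" "v \<in> carrier G" using u v cc by auto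
  \<comment> \<open>The divergence of the two ends passes to the points following them, at the cost
    of one \<open>\<delta>\<close> per replacement.\<close>
  have "gp (c [^] (- m)) (c [^] m) \<le> L + 2 * \<delta>" using schottky_pow[OF c, of m m] m_def by simp
  moreover have "min (gp (c [^] (- m)) (inv g \<otimes> u)) (gp (inv g \<otimes> u) (c [^] m)) - \<delta>
      \<le> gp (c [^] (- m)) (c [^] m)"
    using cc g uvc by (intro gp_four) auto
  moreover have "gp (inv g \<otimes> u) (c [^] m) = gp (c [^] m) (inv g \<otimes> u)"
    using cc g uvc by (intro gp_sym) auto
  ultimately have 1: "gp (c [^] (- m)) (inv g \<otimes> u) \<le> L + 3 * \<delta>"
    using u(2) delta_nonneg by (simp add: min_def split: if_splits)
  moreover have "min (gp (c [^] (- m)) (inv g \<otimes> v)) (gp (inv g \<otimes> v) (inv g \<otimes> u)) - \<delta>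
      \<le> gp (c [^] (- m)) (inv g \<otimes> u)"
    using cc g uvc by (intro gp_four) auto
  ultimately have vu: "gp (inv g \<otimes> v) (inv g \<otimes> u) \<le> L + 4 * \<delta>"
    using v(2) by (simp add: min_def split: if_splits)
  show False
  proof (cases "u = v")
    case True
    then have "len (inv g \<otimes> u) \<le> L + 4 * \<delta>" using vu gp_same g uvc by simp
    moreover have "2 * L + 8 * \<delta> + len c < len (inv g \<otimes> u)" using far u by blast
    ultimately show False using cc len_nonneg[of c] delta_nonneg by linarith
  next
    case False
    \<comment> \<open>Here \<open>u\<close> and \<open>v\<close> are the two opposite powers;
      \<open>i\<close> from 0 to \<open>2 * n\<close> runs through the exponents from
      \<open>- m\<close> to \<open>m\<close>.\<close>
    define x where "x i = inv g \<otimes> c [^] (int i - m)" for i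
    have ends: "x 0 = inv g \<otimes> c [^] (- m)" "x (2 * n) = inv g \<otimes> c [^] m"
      by (auto simp: x_def m_def)
    have xc: "x i \<in> carrier G" for i using g cc by (simp add: x_def)
    have dx: "inv (x i) \<otimes> x j = c [^] (int j - int i)" for i j
    proof -
      have "inv (x i) \<otimes> x j = inv (c [^] (int i - m)) \<otimes> c [^] (int j - m)"
        using g cc by (simp add: x_def inv_mult_group m_assoc inv_mult_cancel)
      then show ?thesis using cc inv_int_pow_mult by simp
    qed
    have "gp (x 0) (x (2 * n)) \<le> L + 4 * \<delta>"
      using vu u v False gp_sym[OF xc xc, of 0 "2 * n"] unfolding ends by auto
    moreover have "\<exists>i\<le>2 * n. len (x i) \<le> gp (x 0) (x (2 * n)) + 2 * \<delta> + len c
        + gp (inv (x i) \<otimes> x 0) (inv (x i) \<otimes> x (2 * n))"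
      using xc cc len_nonneg by (intro path_near_base) (auto simp: dx)
    then obtain i where i: "i \<le> 2 * n" "len (x i) \<le> gp (x 0) (x (2 * n)) + 2 * \<delta> + len c
        + gp (inv (x i) \<otimes> x 0) (inv (x i) \<otimes> x (2 * n))" by blast
    moreover have "gp (inv (x i) \<otimes> x 0) (inv (x i) \<otimes> x (2 * n)) \<le> L + 2 * \<delta>"
      unfolding dx using schottky_pow[OF c, of "int i" "int (2 * n) - int i"] i by simp
    moreover have "2 * L + 8 * \<delta> + len c < len (x i)" using far unfolding x_def by blast
    ultimately show False using delta_nonneg by linarith
  qed
qed

text \<open>With \<open>t\<close> a high power of a hyperbolic element \<open>c\<close> and \<open>g\<close> moving one end of its axis off
  the axis, \<open>t\<close> and \<open>g \<otimes> t\<close> play ping-pong: both come from the same repelling direction, which is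
  harmless for positive words.\<close>

lemma exists_schottky_pair:
  assumes nvc: "\<not> virtually_cyclic G"
  shows "\<exists>E :: bool \<Rightarrow> 'a. \<exists>L. schottky (range E) L \<and> gp (E True) (E False) \<le> L"
proof -
  note d = delta_nonneg
  have "infinite (carrier G)"
  proof
    assume "finite (carrier G)"
    moreover have "rcosets (generate G {\<one>}) \<subseteq> Pow (carrier G)"
      using rcosets_subset_PowG generate_is_subgroup by simp
    ultimately have "finite (rcosets (generate G {\<one>}))" by (meson finite_Pow_iff finite_subset)
    then show False using nvc by (auto simp: virtually_cyclic_def)
  qed
  \<comment> \<open>\<open>10 * \<delta> + 1\<close> is the length
    \<open>2 * L + 4 * \<delta> + 1\<close> required by \<open>schottky_pow_len\<close> for
    \<open>L = 3 * \<delta>\<close>.\<close>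
  then obtain c where c: "c \<in> carrier G" "10 * \<delta> + 1 \<le> len c" "gp (inv c) c \<le> 3 * \<delta>"
    using exists_hyperbolic_element by blast
  define L where "L = 3 * \<delta>"
  have S: "schottky {c} L" using c d by (auto simp: schottky_def L_def)
  have "infinite (rcosets (generate G {c}))" using nvc c by (auto simp: virtually_cyclic_def)
  then obtain g where g: "g \<in> carrier G"
    "\<forall>k\<in>generate G {c}. 2 * L + 8 * \<delta> + len c < len (k \<otimes> g)"
    using exists_far_from_subgroup[of "generate G {c}"] generate_is_subgroup c by blast
  have far: "2 * L + 8 * \<delta> + len c < len (inv g \<otimes> c [^] k)" for k :: int
  proof -
    have "c [^] (- k) \<in> generate G {c}" using generate_pow[OF c(1)] by blast
    then have "2 * L + 8 * \<delta> + len c < len (c [^] (- k) \<otimes> g)" using g by blast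
    moreover have "c [^] (- k) \<otimes> g = inv (inv g \<otimes> c [^] k)"
      using c g by (simp add: int_pow_neg inv_mult_group)
    ultimately show ?thesis using len_inv[of "inv g \<otimes> c [^] k"] c g by simp
  qed
  \<comment> \<open>One \<open>len g\<close> comes from \<open>exists_transverse_power\<close>, the
    other from replacing \<open>inv t\<close> by \<open>inv (g \<otimes> t)\<close>. The
    \<open>len g\<close> in the choice of \<open>n\<close> keeps \<open>g \<otimes> t\<close> long
    along with \<open>t\<close>.\<close>
  define M where "M = L + 4 * \<delta> + 2 * len g"
  have gl: "0 \<le> len g" using g len_nonneg by simp
  obtain n :: nat where n: "2 * M + 4 * \<delta> + len g + 1 \<le> real n" using real_arch_simple by blast
  obtain t where t: "t \<in> {c [^] int n, c [^] (- int n)}"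
    "\<forall>u\<in>{c [^] int n, c [^] (- int n)}. gp (g \<otimes> t) u \<le> L + 4 * \<delta> + len g"
    using exists_transverse_power[OF S g(1) far, of n] by blast
  have tc: "t \<in> carrier G" using t c by auto
  have pair: "t = c [^] int n \<and> inv t = c [^] (- int n) \<or> t = c [^] (- int n) \<and> inv t = c [^] int n"
    using t c by (auto simp: int_pow_neg)
  have "gp (c [^] (- int n)) (c [^] int n) \<le> L + 2 * \<delta>" using schottky_pow[OF S] by simp
  then have tt: "gp (inv t) t \<le> L + 2 * \<delta>"
    using pair gp_sym[of "inv t" t] tc by auto
  have gt: "gp (g \<otimes> t) t \<le> L + 4 * \<delta> + len g" "gp (g \<otimes> t) (inv t) \<le> L + 4 * \<delta> + len g"
    using t pair by auto
  have "real n \<le> len (c [^] int n)" using schottky_pow_len[OF S] c by (simp add: L_def)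
  moreover have "len (c [^] (- int n)) = len (c [^] int n)" using c by (simp add: int_pow_neg len_inv)
  ultimately have lt: "real n \<le> len t" using t by auto
  have "len t \<le> len g + len (g \<otimes> t)"
    using len_mult[of "inv g" "g \<otimes> t"] g tc by (simp add: inv_mult_cancel len_inv)
  then have lgt: "real n - len g \<le> len (g \<otimes> t)" using lt by simp
  have "inv (inv (g \<otimes> t)) \<otimes> inv t = g" using g tc by (simp add: m_assoc)
  then have shift: "gp (inv (g \<otimes> t)) z \<le> gp (inv t) z + len g" if "z \<in> carrier G" for z
    using gp_lip[of "inv (g \<otimes> t)" "inv t" z] that g tc by simp
  define E where "E b = (if b then t else g \<otimes> t)" for b :: bool
  have rE: "range E = {t, g \<otimes> t}" unfolding E_def by (auto simp: UNIV_bool)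
  have sym: "gp (inv t) (g \<otimes> t) = gp (g \<otimes> t) (inv t)" "gp t (g \<otimes> t) = gp (g \<otimes> t) t"
    using gp_sym g tc by auto
  have "schottky (range E) M"
    unfolding schottky_def rE using g tc tt gt lt lgt n d gl S shift[of t] shift[of "g \<otimes> t"] sym
    by (auto simp: M_def schottky_def)
  moreover have "gp (E True) (E False) \<le> M" using gt sym gl by (simp add: E_def M_def)
  ultimately show ?thesis by blast
qed

section \<open>Shortest coset representatives and the tree of cosets\<close>

text \<open>Infinite index gives a coset avoiding a large ball, and finiteness of balls a shortest
  element in it. Shortest representatives are what quasiconvexity controls.\<close>

lemma exists_shortest_far_representative:
  assumes H: "subgroup H G" and inf: "infinite (rcosets H)"
  shows "\<exists>g\<in>carrier G. r < len g \<and> (\<forall>h\<in>H. len g \<le> len (h \<otimes> g))"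
proof -
  have HG: "H \<subseteq> carrier G" using H by (rule subgroup.subset)
  obtain g where g: "g \<in> carrier G" "\<forall>h\<in>H. r < len (h \<otimes> g)"
    using exists_far_from_subgroup[OF H inf] by blast
  define B where "B = {x \<in> carrier G. len x \<le> len g} \<inter> (\<lambda>h. h \<otimes> g) ` H"
  have 1: "\<one> \<otimes> g \<in> (\<lambda>h. h \<otimes> g) ` H" using subgroup.one_closed[OF H] by (rule imageI)
  then have "g \<in> B" using g by (simp add: B_def)
  moreover have "finite B" using finite_ball by (simp add: B_def)
  ultimately obtain x where x: "x \<in> B" "\<And>y. y \<in> B \<Longrightarrow> len x \<le> len y"
    using arg_min_if_finite(1)[of B len] arg_min_least[of B _ len] by blast
  obtain k where k: "k \<in> H" "x = k \<otimes> g" using x by (auto simp: B_def)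
  have "len x \<le> len (h \<otimes> x)" if h: "h \<in> H" for h
  proof (cases "len (h \<otimes> x) \<le> len g")
    case True
    have "h \<otimes> x = (h \<otimes> k) \<otimes> g" using h k g HG by (simp add: m_assoc subset_iff)
    moreover have "h \<otimes> k \<in> H" using H h k by (simp add: subgroup.m_closed)
    ultimately have "h \<otimes> x \<in> (\<lambda>h. h \<otimes> g) ` H" by blast
    then have "h \<otimes> x \<in> B" using True h x HG by (auto simp: B_def)
    then show ?thesis using x by simp
  next
    case False
    then show ?thesis using x by (simp add: B_def)
  qed
  moreover have "r < len x" "x \<in> carrier G" using k g x by (auto simp: B_def)
  ultimately show ?thesis by blast
qed

text \<open>Points of one coset satisfy \<open>f w = h \<otimes> f v\<close>, and
  \<open>len h\<close> is exactly \<open>gp (f w) h + gp (f v) (inv h)\<close>. So for fixed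
  \<open>v\<close> the fibre injects into a ball by \<open>w \<mapsto> h\<close>.\<close>

lemma coset_fibre_bounded:
  assumes H: "subgroup H G" and T: "T \<subseteq> carrier G"
    and gp: "\<And>x h. x \<in> T \<Longrightarrow> h \<in> H \<Longrightarrow> gp x h \<le> K"
    and inj: "inj_on f W" and f: "f ` W \<subseteq> T"
  shows "card {w \<in> W. H #> f w = C} \<le> card {x \<in> carrier G. len x \<le> 2 * K}"
proof (cases "{w \<in> W. H #> f w = C} = {}")
  case True
  then show ?thesis by (simp only: card.empty)
next
  case False
  then obtain v where v: "v \<in> W" "H #> f v = C" by blast
  have HG: "H \<subseteq> carrier G" using H by (rule subgroup.subset)
  have fc: "f w \<in> carrier G" if "w \<in> W" for w using that f T by blast
  let ?q = "\<lambda>w. f w \<otimes> inv (f v)"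
  have "inj_on ?q {w \<in> W. H #> f w = C}"
  proof (rule inj_onI)
    fix a b assume ab: "a \<in> {w \<in> W. H #> f w = C}" "b \<in> {w \<in> W. H #> f w = C}" "?q a = ?q b"
    then have "f a = f b" using fc v by simp
    then show "a = b" using ab inj by (auto dest: inj_onD)
  qed
  moreover have "?q w \<in> {x \<in> carrier G. len x \<le> 2 * K}" if w: "w \<in> W" "H #> f w = C" for w
  proof -
    have "f w \<in> H #> f v" using rcos_self[OF _ H, of "f w"] fc w v by simp
    then obtain h where h: "h \<in> H" "f w = h \<otimes> f v" by (auto simp: r_coset_def)
    have hc: "h \<in> carrier G" "inv h \<in> H" using h HG H subgroup.m_inv_closed by auto
    have "?q w = h" using h hc fc v by (simp add: m_assoc)
    moreover have "len h \<le> 2 * K"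
    proof -
      have "gp (f w) h \<le> K" "gp (f v) (inv h) \<le> K" using gp h hc w v f by auto
      moreover have "len (inv (f w) \<otimes> h) = len (f v)"
        using h hc fc v by (simp add: inv_mult_group m_assoc len_inv)
      moreover have "len (inv (f v) \<otimes> inv h) = len (f w)"
        using h hc fc v len_inv[of "h \<otimes> f v"] by (simp add: inv_mult_group)
      ultimately show ?thesis using hc by (simp add: gp_def len_inv)
    qed
    ultimately show ?thesis using hc by simp
  qed
  ultimately show ?thesis using finite_ball by (intro card_inj_on_le[of ?q]) auto
qed

text \<open>The tree is \<open>w \<mapsto> H g w\<close>, where \<open>g\<close> leaves \<open>H\<close> and \<open>w\<close> runs over the positive words in a
  Schottky pair or in its inverse: these two families of words point in different directions, so
  one of them avoids the direction of \<open>inv g\<close> and does not backtrack along \<open>g\<close>.\<close>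

theorem exists_coset_tree:
  assumes nvc: "\<not> virtually_cyclic G" and H: "subgroup H G" and inf: "infinite (rcosets H)"
    and K: "\<And>g h. \<lbrakk>g \<in> carrier G; \<forall>h\<in>H. len g \<le> len (h \<otimes> g); h \<in> H\<rbrakk> \<Longrightarrow> gp g h \<le> K"
  shows "\<exists>z :: bool list \<Rightarrow> 'a. \<exists>E M. range z \<subseteq> carrier G \<and> range E \<subseteq> carrier G \<and>
    (\<forall>w b. z (w @ [b]) = z w \<otimes> E b) \<and>
    (\<forall>n C. card {w \<in> {w. length w = n}. H #> z w = C} \<le> M)"
proof -
  have HG: "H \<subseteq> carrier G" using H by (rule subgroup.subset)
  obtain E :: "bool \<Rightarrow> 'a" and L where S: "schottky (range E) L" and sep: "gp (E True) (E False) \<le> L"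
    using exists_schottky_pair[OF nvc] by blast
  have EC: "range E \<subseteq> carrier G" using S by (simp add: schottky_def)
  have wc: "lprod (map E w) \<in> carrier G" for w using EC by (intro lprod_closed) auto
  \<comment> \<open>This length makes \<open>gp x g\<close> exceed \<open>K + \<delta>\<close> for
    every tree vertex \<open>x\<close>, so the four-point inequality carries the bound against
    \<open>H\<close> from \<open>g\<close> to \<open>x\<close>.\<close>
  obtain g where g: "g \<in> carrier G" "L + 4 * \<delta> + K < len g" "\<forall>h\<in>H. len g \<le> len (h \<otimes> g)"
    using exists_shortest_far_representative[OF H inf] by blast
  have inj: "inj_on (\<lambda>w. lprod (map E w)) {w. length w = n}" for n
    by (intro inj_onI, rule schottky_distinct[OF S order_refl sep]) simp_all
  have "\<exists>F :: bool \<Rightarrow> 'a. range F \<subseteq> carrier G \<and> (\<forall>w. gp (lprod (map F w)) (inv g) \<le> L + 3 * \<delta>) \<and>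
      (\<forall>n. inj_on (\<lambda>w. lprod (map F w)) {w. length w = n})"
  proof (cases "\<forall>w. gp (lprod (map E w)) (inv g) \<le> L + 3 * \<delta>")
    case True
    then show ?thesis using EC inj by blast
  next
    case False
    then obtain w where w: "L + 3 * \<delta> < gp (lprod (map E w)) (inv g)" by (auto simp: not_le)
    \<comment> \<open>The word \<open>w\<close> points along \<open>inv g\<close>, and inverses of
      words diverge from \<open>w\<close>, hence from \<open>inv g\<close>. Products over
      \<open>F\<close> are inverses of products of reversed words over \<open>E\<close>, so they
      stay distinct.\<close>
    define F where "F = (\<lambda>b. inv (E b))"
    have F: "lprod (map F v) = inv (lprod (map E (rev v)))" for v
      using lprod_map_inv[of "map E v"] EC by (auto simp: F_def comp_def rev_map image_subset_iff)
    have "gp (lprod (map F v)) (inv g) \<le> L + 3 * \<delta>" for v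
    proof -
      have "gp (inv (lprod (map E (rev v)))) (lprod (map E w)) \<le> L + 2 * \<delta>"
        by (rule schottky_word_word[OF S]) auto
      then show ?thesis
        using gp_four[of "inv (lprod (map E (rev v)))" "inv g" "lprod (map E w)"] w wc g F
          gp_sym[of "inv g" "lprod (map E w)"] by (simp add: min_def split: if_splits)
    qed
    moreover have "inj_on (\<lambda>w. lprod (map F w)) {w. length w = n}" for n
    proof (rule inj_onI)
      fix u v :: "bool list" assume uv: "u \<in> {w. length w = n}" "v \<in> {w. length w = n}"
        "lprod (map F u) = lprod (map F v)"
      then have "lprod (map E (rev u)) = lprod (map E (rev v))"
        using F wc inv_inv by metis
      then have "rev u = rev v" using uv inj[of n] by (auto dest: inj_onD)
      then show "u = v" by simp
    qed
    moreover have "range F \<subseteq> carrier G" using EC by (auto simp: F_def)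
    ultimately show ?thesis by blast
  qed
  then obtain F :: "bool \<Rightarrow> 'a" where F: "range F \<subseteq> carrier G" "\<And>w. gp (lprod (map F w)) (inv g) \<le> L + 3 * \<delta>"
    "\<And>n. inj_on (\<lambda>w. lprod (map F w)) {w. length w = n}" by blast
  have fc: "lprod (map F w) \<in> carrier G" for w using F by (intro lprod_closed) auto
  let ?T = "range (\<lambda>w. g \<otimes> lprod (map F w))"
  have "gp x h \<le> K + \<delta>" if x: "x \<in> ?T" and h: "h \<in> H" for x h
  proof -
    obtain w where w: "x = g \<otimes> lprod (map F w)" using x by blast
    have xc: "x \<in> carrier G" "h \<in> carrier G" using w g fc h HG by auto
    have "len g - L - 3 * \<delta> \<le> gp x g" using gp_mult_left[of g] F(2)[of w] g fc w by simp
    then show ?thesis using gp_four[of g x h] K[OF g(1,3) h] g xc gp_sym[of g x]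
      by (simp add: min_def split: if_splits)
  qed
  moreover have "inj_on (\<lambda>w. g \<otimes> lprod (map F w)) {w. length w = n}" for n
    using F(3)[of n] g fc by (auto simp: inj_on_def)
  ultimately have "\<forall>n C. card {w \<in> {w. length w = n}. H #> (g \<otimes> lprod (map F w)) = C}
      \<le> card {x \<in> carrier G. len x \<le> 2 * (K + \<delta>)}"
    using g fc by (intro allI coset_fibre_bounded[OF H, of ?T]) auto
  moreover have "g \<otimes> lprod (map F (w @ [b])) = (g \<otimes> lprod (map F w)) \<otimes> F b" for w b
    using lprod_append[of "map F w" "[F b]"] F(1) g(1) fc by (auto simp: m_assoc image_subset_iff)
  ultimately show ?thesis using g(1) F(1) fc
    by (intro exI[of _ "\<lambda>w. g \<otimes> lprod (map F w)"] exI[of _ F]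
      exI[of _ "card {x \<in> carrier G. len x \<le> 2 * (K + \<delta>)}"] conjI) auto
qed

end
section \<open>The word metric\<close>

locale marked_group = group G for G :: "('a, 'm) monoid_scheme" (structure) +
  fixes \<pi> :: "'b \<Rightarrow> 'a" and A :: "'b set"
  assumes finite_letters: "finite A"
    and marking_closed: "\<pi> ` A \<subseteq> carrier G"
    and marking_generates: "generate G (\<pi> ` A) = carrier G"
begin

abbreviation steps :: "('b \<times> bool) set" where "steps \<equiv> A \<times> UNIV"

abbreviation gs :: "'b \<times> bool \<Rightarrow> 'a" where "gs \<equiv> gen_step G \<pi>"

definition path_end :: "'a \<Rightarrow> ('b \<times> bool) list \<Rightarrow> 'a" where
  "path_end x w = foldl (\<lambda>x s. x \<otimes> gs s) x w"

definition wlen :: "'a \<Rightarrow> real" where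
  "wlen x = real (word_dist G \<pi> A \<one> x)"

lemma gs_closed: "s \<in> steps \<Longrightarrow> gs s \<in> carrier G"
  using marking_closed by (auto simp: gen_step_def)

lemma path_end_closed: "\<lbrakk>set w \<subseteq> steps; x \<in> carrier G\<rbrakk> \<Longrightarrow> path_end x w \<in> carrier G"
  by (induction w arbitrary: x) (auto simp: path_end_def gs_closed)

lemma path_end_append: "path_end x (v @ w) = path_end (path_end x v) w"
  by (simp add: path_end_def)

lemma path_end_mult:
  "\<lbrakk>set w \<subseteq> steps; x \<in> carrier G; y \<in> carrier G\<rbrakk> \<Longrightarrow> path_end (x \<otimes> y) w = x \<otimes> path_end y w"
  by (induction w arbitrary: y) (auto simp: path_end_def gs_closed m_assoc)

lemma path_end_from_one:
  "\<lbrakk>set w \<subseteq> steps; x \<in> carrier G\<rbrakk> \<Longrightarrow> path_end x w = x \<otimes> path_end \<one> w"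
  using path_end_mult[of w x \<one>] by simp

lemma path_end_surj:
  assumes "x \<in> carrier G"
  shows "\<exists>w. set w \<subseteq> steps \<and> x = path_end \<one> w"
proof -
  have "x \<in> generate G (\<pi> ` A)" using assms marking_generates by simp
  then show ?thesis
  proof (induction rule: generate.induct)
    case one
    show ?case by (intro exI[of _ "[]"]) (simp add: path_end_def)
  next
    case (incl h)
    then obtain a where "a \<in> A" "h = \<pi> a" by blast
    then show ?case using marking_closed
      by (intro exI[of _ "[(a, True)]"]) (auto simp: path_end_def gen_step_def)
  next
    case (inv h)
    then obtain a where "a \<in> A" "h = \<pi> a" by blast
    then show ?case using marking_closed
      by (intro exI[of _ "[(a, False)]"]) (auto simp: path_end_def gen_step_def)
  next
    case (eng h1 h2)
    then obtain v w where vw: "set v \<subseteq> steps" "h1 = path_end \<one> v"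
      "set w \<subseteq> steps" "h2 = path_end \<one> w" by blast
    then show ?case
      by (intro exI[of _ "v @ w"])
        (auto simp: path_end_append path_end_from_one[of w "path_end \<one> v"] path_end_closed)
  qed
qed

lemma path_end_inv:
  assumes "set w \<subseteq> steps"
  shows "inv (path_end \<one> w) = path_end \<one> (rev (map (\<lambda>s. (fst s, \<not> snd s)) w))"
  using assms
proof (induction w)
  case Nil
  show ?case by (simp add: path_end_def)
next
  case (Cons s w)
  let ?f = "\<lambda>s :: 'b \<times> bool. (fst s, \<not> snd s)"
  have s: "s \<in> steps" "gs s \<in> carrier G" and w: "set w \<subseteq> steps" using Cons.prems gs_closed by auto
  have r: "set (rev (map ?f w)) \<subseteq> steps" using w by auto
  have "gs (?f s) = inv (gs s)" using s marking_closed by (auto simp: gen_step_def)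
  then have "path_end \<one> (rev (map ?f (s # w))) = inv (path_end \<one> w) \<otimes> inv (gs s)"
    using Cons.IH[OF w] by (simp add: path_end_append) (simp add: path_end_def)
  moreover have "path_end \<one> (s # w) = gs s \<otimes> path_end \<one> w"
    using path_end_from_one[OF w s(2)] s by (simp add: path_end_def)
  ultimately show ?case using s w path_end_closed by (simp add: inv_mult_group)
qed

lemma word_dist_eq:
  "word_dist G \<pi> A x y = (LEAST n. \<exists>w. set w \<subseteq> steps \<and> length w = n \<and> y = path_end x w)"
  by (simp add: word_dist_def path_end_def)

lemma word_dist_le: "set w \<subseteq> steps \<Longrightarrow> word_dist G \<pi> A x (path_end x w) \<le> length w"
  unfolding word_dist_eq by (intro Least_le) auto

lemma word_dist_left:
  assumes "x \<in> carrier G" "y \<in> carrier G"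
  shows "real (word_dist G \<pi> A x y) = wlen (inv x \<otimes> y)"
proof -
  have "y = path_end x w \<longleftrightarrow> inv x \<otimes> y = path_end \<one> w" if "set w \<subseteq> steps" for w
    using path_end_from_one[OF that assms(1)] path_end_closed[OF that] assms
    by (metis inv_closed inv_solve_left one_closed)
  then show ?thesis unfolding wlen_def word_dist_eq by (metis (no_types, lifting))
qed

lemma wlen_word:
  assumes "x \<in> carrier G"
  shows "\<exists>w. set w \<subseteq> steps \<and> real (length w) = wlen x \<and> x = path_end \<one> w"
proof -
  have "\<exists>n w. set w \<subseteq> steps \<and> length w = n \<and> x = path_end \<one> w" using path_end_surj[OF assms] by blast
  from LeastI_ex[OF this] show ?thesis unfolding wlen_def word_dist_eq by auto
qed

lemma wlen_le: "set w \<subseteq> steps \<Longrightarrow> wlen (path_end \<one> w) \<le> real (length w)"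
  unfolding wlen_def using word_dist_le by simp

lemma wlen_one: "wlen \<one> = 0"
  using wlen_le[of "[]"] by (simp add: path_end_def wlen_def)

lemma wlen_mult:
  assumes "x \<in> carrier G" "y \<in> carrier G"
  shows "wlen (x \<otimes> y) \<le> wlen x + wlen y"
proof -
  obtain v w where vw: "set v \<subseteq> steps" "real (length v) = wlen x" "x = path_end \<one> v"
      "set w \<subseteq> steps" "real (length w) = wlen y" "y = path_end \<one> w"
    using wlen_word assms by metis
  then have "x \<otimes> y = path_end \<one> (v @ w)"
    using path_end_from_one[of w x] assms by (simp add: path_end_append)
  then show ?thesis using wlen_le[of "v @ w"] vw by simp
qed

lemma wlen_inv:
  assumes "x \<in> carrier G"
  shows "wlen (inv x) = wlen x"
proof -
  have le: "wlen (inv y) \<le> wlen y" if "y \<in> carrier G" for y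
  proof -
    obtain w where w: "set w \<subseteq> steps" "real (length w) = wlen y" "y = path_end \<one> w"
      using wlen_word \<open>y \<in> carrier G\<close> by blast
    let ?w = "rev (map (\<lambda>s. (fst s, \<not> snd s)) w)"
    have "set ?w \<subseteq> steps" using w by auto
    then show ?thesis using wlen_le[of ?w] path_end_inv w by simp
  qed
  show ?thesis using le[OF assms] le[of "inv x"] assms by simp
qed

lemma finite_wlen_ball: "finite {x \<in> carrier G. wlen x \<le> r}"
proof -
  let ?W = "{w. set w \<subseteq> steps \<and> length w \<le> nat \<lfloor>r\<rfloor>}"
  have "{x \<in> carrier G. wlen x \<le> r} \<subseteq> path_end \<one> ` ?W"
  proof
    fix x assume x: "x \<in> {x \<in> carrier G. wlen x \<le> r}"
    then obtain w where w: "set w \<subseteq> steps" "real (length w) = wlen x" "x = path_end \<one> w"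
      using wlen_word by blast
    then have "length w \<le> nat \<lfloor>r\<rfloor>" using x by (simp add: le_nat_floor)
    then show "x \<in> path_end \<one> ` ?W" using w by blast
  qed
  moreover have "finite ?W" using finite_letters by (intro finite_lists_length_le) simp
  ultimately show ?thesis by (meson finite_imageI finite_subset)
qed

text \<open>The two pieces have length at most \<open>n\<close> and \<open>length w - n\<close>, and
  together at least \<open>length w\<close>, so both bounds are attained.\<close>

lemma geodesic_word_prefix:
  assumes w: "set w \<subseteq> steps" "real (length w) = wlen (path_end \<one> w)" and n: "n \<le> length w"
  defines "u \<equiv> path_end \<one> (take n w)"
  shows "u \<in> carrier G" "wlen u = real n" "wlen (inv u \<otimes> path_end \<one> w) = real (length w - n)"
proof -
  have s: "set (take n w) \<subseteq> steps" "set (drop n w) \<subseteq> steps"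
    using w(1) set_take_subset set_drop_subset by fast+
  let ?v = "path_end \<one> (drop n w)"
  show u: "u \<in> carrier G" using s path_end_closed by (simp add: u_def)
  have v: "?v \<in> carrier G" using s path_end_closed by simp
  have x: "path_end \<one> w = u \<otimes> ?v"
    using path_end_append[of \<one> "take n w" "drop n w"] path_end_from_one[OF s(2) u] by (simp add: u_def)
  then have iv: "inv u \<otimes> path_end \<one> w = ?v" using u v by (simp add: m_assoc[symmetric])
  have "wlen u \<le> real n" "wlen ?v \<le> real (length w - n)"
    using wlen_le[OF s(1)] wlen_le[OF s(2)] n by (auto simp: u_def)
  moreover have "real (length w) \<le> wlen u + wlen ?v" using wlen_mult[OF u v] x w by simp
  ultimately show "wlen u = real n" "wlen (inv u \<otimes> path_end \<one> w) = real (length w - n)"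
    using n iv by (auto simp: of_nat_diff)
qed

lemma hyperbolic_length_wlen:
  assumes "word_hyperbolic G \<pi> A"
  shows "\<exists>\<delta>. hyperbolic_length G wlen \<delta>"
proof -
  obtain \<delta> where d: "\<And>x y z. \<lbrakk>x \<in> carrier G; y \<in> carrier G; z \<in> carrier G\<rbrakk> \<Longrightarrow>
      min (gromov_product G \<pi> A \<one> x y) (gromov_product G \<pi> A \<one> y z) - \<delta> \<le> gromov_product G \<pi> A \<one> x z"
    using assms unfolding word_hyperbolic_def by (meson one_closed)
  have g: "gromov_product G \<pi> A \<one> x y = (wlen x + wlen y - wlen (inv x \<otimes> y)) / 2"
    if "x \<in> carrier G" "y \<in> carrier G" for x y
    using that by (simp add: gromov_product_def word_dist_left wlen_inv)
  have "hyperbolic_length G wlen \<delta>"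
  proof
    fix x n assume x: "x \<in> carrier G" "real n \<le> wlen x"
    then obtain w where w: "set w \<subseteq> steps" "real (length w) = wlen x" "x = path_end \<one> w"
      using wlen_word by blast
    then show "\<exists>u\<in>carrier G. \<exists>v\<in>carrier G. x = u \<otimes> v \<and> wlen u = real n \<and> wlen v = wlen x - real n"
      using geodesic_word_prefix[of w n] x
      by (intro bexI[of _ "path_end \<one> (take n w)"] bexI[of _ "inv (path_end \<one> (take n w)) \<otimes> x"])
        (auto simp: m_assoc[symmetric] of_nat_diff)
  next
    fix x y z assume "x \<in> carrier G" "y \<in> carrier G" "z \<in> carrier G"
    then show "min ((wlen x + wlen y - wlen (inv x \<otimes> y)) / 2) ((wlen y + wlen z - wlen (inv y \<otimes> z)) / 2) - \<delta>
          \<le> (wlen x + wlen z - wlen (inv x \<otimes> z)) / 2"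
      using d g by simp
  qed (simp_all add: wlen_one wlen_inv wlen_mult finite_wlen_ball)
  then show ?thesis by blast
qed

text \<open>A geodesic from \<open>\<one>\<close> to \<open>h\<close> comes within about
  \<open>wlen g - gp g h\<close> of \<open>g\<close>, so by quasiconvexity \<open>H\<close> comes
  nearly as close. But a shortest representative \<open>g\<close> has distance \<open>wlen g\<close>
  from \<open>H\<close>.\<close>

lemma quasiconvex_gp_bound:
  assumes hyp: "hyperbolic_length G wlen \<delta>" and H: "subgroup H G"
    and qc: "quasiconvex G \<pi> A H"
  shows "\<exists>K. \<forall>g\<in>carrier G. (\<forall>h\<in>H. wlen g \<le> wlen (h \<otimes> g)) \<longrightarrow>
    (\<forall>h\<in>H. hyperbolic_length.gp G wlen g h \<le> K)"
proof -
  interpret hyperbolic_length G wlen \<delta> by (rule hyp)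
  have HG: "H \<subseteq> carrier G" using H by (rule subgroup.subset)
  obtain C where C: "\<And>xs x. \<lbrakk>cayley_geodesic G \<pi> A xs; hd xs \<in> H; last xs \<in> H; x \<in> set xs\<rbrakk> \<Longrightarrow>
      \<exists>h\<in>H. real (word_dist G \<pi> A x h) \<le> C"
    using qc unfolding quasiconvex_def by blast
  have "gp g h \<le> 2 * \<delta> + 1 + C"
    if g: "g \<in> carrier G" and short: "\<forall>h\<in>H. wlen g \<le> wlen (h \<otimes> g)" and h: "h \<in> H" for g h
  proof -
    have hc: "h \<in> carrier G" using h HG by blast
    obtain w where w: "set w \<subseteq> steps" "real (length w) = wlen (path_end \<one> w)" "h = path_end \<one> w"
      using wlen_word[OF hc] by auto
    define k where "k = length w"
    define y where "y i = path_end \<one> (take i w)" for i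
    have y: "y i \<in> carrier G" "wlen (y i) = real i" "wlen (inv (y i) \<otimes> h) = real (k - i)" if "i \<le> k" for i
      using geodesic_word_prefix[OF w(1,2), of i] that w(3) by (auto simp: y_def k_def)
    have ends: "y 0 = \<one>" "y k = h" using w by (auto simp: y_def k_def path_end_def)
    have ystep: "w ! i \<in> steps" "y (Suc i) = y i \<otimes> gs (w ! i)" if "i < k" for i
      using that subsetD[OF w(1) nth_mem]
      by (simp_all add: y_def k_def take_Suc_conv_app_nth path_end_def)
    define xs where "xs = map y [0..<Suc k]"
    have xs: "length xs = Suc k" "\<And>i. i \<le> k \<Longrightarrow> xs ! i = y i"
      by (auto simp: xs_def nth_append simp del: upt_Suc)
    have "xs \<noteq> []" using xs(1) by auto
    then have "hd xs = \<one>" "last xs = h" using xs ends hd_conv_nth[of xs] last_conv_nth[of xs] by auto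
    moreover have "set xs \<subseteq> carrier G" using y by (auto simp: xs_def)
    moreover have "real k = wlen h" using w by (simp add: k_def)
    moreover have "\<exists>s\<in>steps. xs ! Suc i = xs ! i \<otimes> gs s" if "Suc i < length xs" for i
      using that xs ystep[of i] by (intro bexI[of _ "w ! i"]) auto
    ultimately have "cayley_geodesic G \<pi> A xs"
      unfolding cayley_geodesic_def using xs(1) \<open>xs \<noteq> []\<close> by (auto simp: wlen_def)
    then have geod: "\<exists>h'\<in>H. real (word_dist G \<pi> A v h') \<le> C" if "v \<in> set xs" for v
      using C[of xs v] \<open>hd xs = \<one>\<close> \<open>last xs = h\<close> h subgroup.one_closed[OF H] that by simp
    have near: "\<exists>h'\<in>H. wlen (inv (y i) \<otimes> h') \<le> C" if i: "i \<le> k" for i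
    proof -
      have "y i \<in> set xs" using i by (auto simp: xs_def simp del: upt_Suc)
      from geod[OF this] obtain h' where h': "h' \<in> H" "real (word_dist G \<pi> A (y i) h') \<le> C" by blast
      then show ?thesis using word_dist_left[of "y i" h'] y(1)[OF i] HG by (intro bexI[of _ h']) auto
    qed
    \<comment> \<open>Translation by \<open>inv g\<close> puts \<open>g\<close> at the base point of
      \<open>path_near_base\<close>.\<close>
    define x where "x i = inv g \<otimes> y i" for i
    have dx: "inv (x i) \<otimes> x j = inv (y i) \<otimes> y j" if "i \<le> k" "j \<le> k" for i j
      using y that g by (simp add: x_def inv_mult_group m_assoc inv_mult_cancel)
    have "\<exists>i\<le>k. wlen (x i) \<le> gp (x 0) (x k) + 2 * \<delta> + 1 + gp (inv (x i) \<otimes> x 0) (inv (x i) \<otimes> x k)"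
    proof (rule path_near_base)
      show "x i \<in> carrier G" if "i \<le> k" for i using y that g by (simp add: x_def)
      fix i assume i: "i < k"
      have "inv (y i) \<otimes> y (Suc i) = path_end \<one> [w ! i]"
        using ystep[OF i] y i gs_closed by (simp add: inv_mult_cancel path_end_def)
      then show "wlen (inv (x i) \<otimes> x (Suc i)) \<le> 1"
        using dx[of i "Suc i"] i wlen_le[of "[w ! i]"] ystep by simp
    qed simp
    then obtain i where i: "i \<le> k"
      "wlen (x i) \<le> gp (x 0) (x k) + 2 * \<delta> + 1 + gp (inv (x i) \<otimes> x 0) (inv (x i) \<otimes> x k)" by blast
    \<comment> \<open>Up to translation this is the product of \<open>\<one>\<close> and
      \<open>h\<close> seen from \<open>y i\<close>, which lies on a geodesic between them.\<close>
    have "gp (inv (x i) \<otimes> x 0) (inv (x i) \<otimes> x k) = 0"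
    proof -
      have "gp (inv (x i) \<otimes> x 0) (inv (x i) \<otimes> x k) = gp (inv (y i)) (inv (y i) \<otimes> h)"
        using dx i ends y by simp
      also have "\<dots> = (real i + real (k - i) - wlen h) / 2"
        using y i hc by (simp add: gp_def wlen_inv inv_mult_cancel)
      finally show ?thesis using i \<open>real k = wlen h\<close> by (simp add: of_nat_diff)
    qed
    moreover have "gp (x 0) (x k) = wlen g - gp g h"
      using g hc by (simp add: x_def ends gp_def inv_mult_group m_assoc inv_mult_cancel wlen_inv field_simps)
    moreover obtain h' where h': "h' \<in> H" "wlen (inv (y i) \<otimes> h') \<le> C" using near i by blast
    have "wlen g \<le> wlen (x i) + C"
    proof -
      have c: "h' \<in> carrier G" "inv h' \<in> H" using h' HG H subgroup.m_inv_closed by auto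
      have "wlen g \<le> wlen (inv h' \<otimes> g)" using short c by blast
      also have "\<dots> \<le> wlen (inv h' \<otimes> y i) + wlen (inv (y i) \<otimes> g)"
        using len_triangle c y i g by blast
      also have "\<dots> \<le> C + wlen (x i)"
        using h' len_inv_mult_sym[of h' "y i"] len_inv_mult_sym[of "y i" g] c y i g by (simp add: x_def)
      finally show ?thesis by simp
    qed
    ultimately show ?thesis using i by simp
  qed
  then show ?thesis by blast
qed

end
section \<open>Random walk on the cosets\<close>

locale coset_walk = marked_group G \<pi> A for G :: "('a, 'm) monoid_scheme" (structure) and \<pi> :: "'b \<Rightarrow> 'a" and A +
  fixes H :: "'a set"
  assumes subgroup_H: "subgroup H G"
    and letters_nonempty: "A \<noteq> {}"
begin

abbreviation Y :: "'a set set" where "Y \<equiv> rcosets H"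

definition avg :: "('a set \<Rightarrow> real) \<Rightarrow> 'a set \<Rightarrow> real" where
  "avg f C = (\<Sum>s\<in>steps. f (C #> gs s)) / (2 * real (card A))"

text \<open>\<open>avg\<close> is the transition operator of the walk, so this is the probability
  that the walk from \<open>C\<close> is at \<open>H\<close> at time \<open>n\<close>, for the first
  time or not.\<close>

definition return_prob :: "nat \<Rightarrow> 'a set \<Rightarrow> real" where
  "return_prob n = (avg ^^ n) (\<lambda>C. of_bool (C = H))"

text \<open>A bound on the Dirichlet energy, each edge counted in both directions; finite partial
  sums avoid any question of convergence.\<close>

definition dirichlet_le :: "('a set \<Rightarrow> real) \<Rightarrow> real \<Rightarrow> bool" where
  "dirichlet_le f D \<longleftrightarrow> (\<forall>U. finite U \<and> U \<subseteq> Y \<longrightarrow> (\<Sum>C\<in>U. \<Sum>s\<in>steps. (f C - f (C #> gs s))\<^sup>2) \<le> D)"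

lemma H_subset: "H \<subseteq> carrier G"
  using subgroup_H by (rule subgroup.subset)

lemma Y_subset: "C \<in> Y \<Longrightarrow> C \<subseteq> carrier G"
  using rcosets_subset_PowG[OF subgroup_H] by auto

lemma coset_in_Y: "x \<in> carrier G \<Longrightarrow> H #> x \<in> Y"
  using H_subset by (auto simp: RCOSETS_def)

lemma H_in_Y: "H \<in> Y"
  using coset_in_Y[of \<one>] H_subset by simp

lemma Y_mult_assoc: "\<lbrakk>C \<in> Y; x \<in> carrier G; y \<in> carrier G\<rbrakk> \<Longrightarrow> (C #> x) #> y = C #> (x \<otimes> y)"
  using Y_subset coset_mult_assoc by blast

lemma Y_mult_one: "C \<in> Y \<Longrightarrow> C #> \<one> = C"
  using Y_subset by simp

lemma Y_mult_closed:
  assumes "C \<in> Y" "x \<in> carrier G"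
  shows "C #> x \<in> Y"
proof -
  obtain y where "y \<in> carrier G" "C = H #> y" using assms by (auto simp: RCOSETS_def)
  then show ?thesis using assms coset_in_Y coset_mult_assoc[OF H_subset] by simp
qed

lemma Y_mult_cancel: "\<lbrakk>C \<in> Y; x \<in> carrier G\<rbrakk> \<Longrightarrow> (C #> x) #> inv x = C"
  by (simp add: Y_mult_assoc Y_mult_one)

lemma Y_mult_inj: "x \<in> carrier G \<Longrightarrow> inj_on (\<lambda>C. C #> x) Y"
  using Y_mult_cancel by (intro inj_on_inverseI[of _ "\<lambda>C. C #> inv x"]) auto

lemma card_steps: "real (card steps) = 2 * real (card A)" "0 < real (card A)"
  using finite_letters letters_nonempty by (auto simp: card_cartesian_product card_gt_0_iff)

lemma finite_steps: "finite steps"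
  using finite_letters by simp

lemma avg_const: "avg (\<lambda>_. c) C = c"
  using card_steps by (simp add: avg_def)

lemma avg_sum: "avg (\<lambda>C. \<Sum>i\<in>I. f i C) C = (\<Sum>i\<in>I. avg (f i) C)"
  unfolding avg_def by (subst sum.swap) (simp add: sum_divide_distrib)

lemma avg_mult_right: "avg (\<lambda>C. f C * c) C = avg f C * c"
  by (simp add: avg_def sum_distrib_right)

lemma avg_cong: "\<lbrakk>C \<in> Y; \<And>C. C \<in> Y \<Longrightarrow> f C = g C\<rbrakk> \<Longrightarrow> avg f C = avg g C"
  unfolding avg_def using Y_mult_closed gs_closed
  by (intro arg_cong[where f = "\<lambda>x. x / _"] sum.cong) auto

lemma avg_nonneg: "\<lbrakk>C \<in> Y; \<And>C. C \<in> Y \<Longrightarrow> 0 \<le> f C\<rbrakk> \<Longrightarrow> 0 \<le> avg f C"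
  unfolding avg_def using Y_mult_closed gs_closed
  by (intro divide_nonneg_nonneg sum_nonneg) auto

lemma return_prob_0: "return_prob 0 C = of_bool (C = H)"
  by (simp add: return_prob_def)

lemma return_prob_Suc: "return_prob (Suc n) = avg (return_prob n)"
  by (simp add: return_prob_def)

lemma return_prob_nonneg: "C \<in> Y \<Longrightarrow> 0 \<le> return_prob n C"
  by (induction n arbitrary: C) (auto simp: return_prob_0 return_prob_Suc intro: avg_nonneg)

text \<open>Each step enlarges the support to finitely many translates. This makes truncated Green
  functions finitely supported.\<close>

lemma return_prob_finite_support: "finite {C \<in> Y. return_prob n C \<noteq> 0}"
proof (induction n)
  case 0
  show ?case by (simp add: return_prob_0)
next
  case (Suc n)
  let ?V = "{C \<in> Y. return_prob n C \<noteq> 0}"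
  have "{C \<in> Y. return_prob (Suc n) C \<noteq> 0} \<subseteq> (\<Union>s\<in>steps. (\<lambda>D. D #> inv (gs s)) ` ?V)"
  proof
    fix C assume "C \<in> {C \<in> Y. return_prob (Suc n) C \<noteq> 0}"
    then have C: "C \<in> Y" "avg (return_prob n) C \<noteq> 0" by (auto simp: return_prob_Suc)
    then obtain s where s: "s \<in> steps" "return_prob n (C #> gs s) \<noteq> 0"
      unfolding avg_def by (metis (no_types, lifting) div_0 sum.neutral)
    then have "C #> gs s \<in> ?V" using C Y_mult_closed gs_closed by simp
    moreover have "C = (C #> gs s) #> inv (gs s)" using C s Y_mult_cancel gs_closed by simp
    ultimately show "C \<in> (\<Union>s\<in>steps. (\<lambda>D. D #> inv (gs s)) ` ?V)" using s(1) by blast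
  qed
  moreover have "finite (\<Union>s\<in>steps. (\<lambda>D. D #> inv (gs s)) ` ?V)"
    using Suc finite_steps by blast
  ultimately show ?case by (rule finite_subset)
qed

section \<open>Dirichlet energy\<close>

text \<open>Right translation permutes the cosets, so the left side is a sum of \<open>F\<close>
  over distinct cosets, to which only those in \<open>V\<close> contribute.\<close>

lemma sum_translate_le:
  fixes F :: "'a set \<Rightarrow> real"
  assumes t: "t \<in> carrier G" and U: "finite U" "U \<subseteq> Y" and V: "finite V" "V \<subseteq> Y"
    and F: "\<And>C. 0 \<le> F C" "\<And>C. C \<in> Y - V \<Longrightarrow> F C = 0"
  shows "(\<Sum>C\<in>U. F (C #> t)) \<le> (\<Sum>C\<in>V. F C)"
proof -
  let ?T = "(\<lambda>C. C #> t) ` U"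
  have "(\<Sum>C\<in>U. F (C #> t)) = (\<Sum>C\<in>?T. F C)"
    using inj_on_subset[OF Y_mult_inj[OF t] U(2)] by (simp add: sum.reindex)
  also have "\<dots> \<le> (\<Sum>C\<in>?T \<union> V. F C)" using U V F by (intro sum_mono2) auto
  also have "\<dots> = (\<Sum>C\<in>V. F C)"
    using U V F Y_mult_closed t by (intro sum.mono_neutral_right) auto
  finally show ?thesis .
qed

text \<open>Summation by parts: on expanding the square, both square terms contribute at most the
  sum over \<open>V\<close>, since translations permute the cosets, and the cross terms assemble
  into \<open>avg f\<close>.\<close>

lemma dirichlet_le_energy:
  assumes V: "finite V" "V \<subseteq> Y" and f: "\<And>C. C \<in> Y - V \<Longrightarrow> f C = 0"
  shows "dirichlet_le f (4 * real (card A) * (\<Sum>C\<in>V. f C * (f C - avg f C)))"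
  unfolding dirichlet_le_def
proof (intro allI impI)
  fix U assume U: "finite U \<and> U \<subseteq> Y"
  let ?W = "U \<union> V"
  let ?d = "2 * real (card A)"
  have d: "0 < ?d" using card_steps by simp
  have W: "finite ?W" "?W \<subseteq> Y" using U V by auto
  have sq: "(\<Sum>C\<in>?W. (f C)\<^sup>2) = (\<Sum>C\<in>V. (f C)\<^sup>2)"
    using W f by (intro sum.mono_neutral_right) auto
  have cr: "(\<Sum>C\<in>?W. f C * avg f C) = (\<Sum>C\<in>V. f C * avg f C)"
    using W f by (intro sum.mono_neutral_right) auto
  have "(\<Sum>C\<in>U. \<Sum>s\<in>steps. (f C - f (C #> gs s))\<^sup>2) \<le> (\<Sum>C\<in>?W. \<Sum>s\<in>steps. (f C - f (C #> gs s))\<^sup>2)"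
    using W by (intro sum_mono2 sum_nonneg) auto
  also have "\<dots> = (\<Sum>C\<in>?W. ?d * (f C)\<^sup>2 - 2 * ?d * (f C * avg f C) + (\<Sum>s\<in>steps. (f (C #> gs s))\<^sup>2))"
  proof (rule sum.cong[OF refl])
    fix C
    have "(\<Sum>s\<in>steps. (f C - f (C #> gs s))\<^sup>2)
        = (\<Sum>s\<in>steps. (f C)\<^sup>2 - 2 * f C * f (C #> gs s) + (f (C #> gs s))\<^sup>2)"
      by (intro sum.cong) (auto simp: power2_diff)
    also have "\<dots> = ?d * (f C)\<^sup>2 - 2 * f C * (\<Sum>s\<in>steps. f (C #> gs s)) + (\<Sum>s\<in>steps. (f (C #> gs s))\<^sup>2)"
      using card_steps by (simp add: sum.distrib sum_subtractf sum_distrib_left)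
    also have "(\<Sum>s\<in>steps. f (C #> gs s)) = ?d * avg f C" using d by (simp add: avg_def)
    finally show "(\<Sum>s\<in>steps. (f C - f (C #> gs s))\<^sup>2)
        = ?d * (f C)\<^sup>2 - 2 * ?d * (f C * avg f C) + (\<Sum>s\<in>steps. (f (C #> gs s))\<^sup>2)" by simp
  qed
  also have "\<dots> = ?d * (\<Sum>C\<in>V. (f C)\<^sup>2) - 2 * ?d * (\<Sum>C\<in>V. f C * avg f C)
      + (\<Sum>s\<in>steps. \<Sum>C\<in>?W. (f (C #> gs s))\<^sup>2)"
    unfolding sum.distrib sum_subtractf sum_distrib_left[symmetric] sq cr
    by (simp add: sum.swap[of _ _ ?W])
  also have "(\<Sum>s\<in>steps. \<Sum>C\<in>?W. (f (C #> gs s))\<^sup>2) \<le> (\<Sum>s\<in>steps. \<Sum>C\<in>V. (f C)\<^sup>2)"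
    using W V f gs_closed by (intro sum_mono sum_translate_le) auto
  also have "\<dots> = ?d * (\<Sum>C\<in>V. (f C)\<^sup>2)" using card_steps by simp
  finally show "(\<Sum>C\<in>U. \<Sum>s\<in>steps. (f C - f (C #> gs s))\<^sup>2)
      \<le> 4 * real (card A) * (\<Sum>C\<in>V. f C * (f C - avg f C))"
    by (simp add: sum_subtractf sum_distrib_left algebra_simps power2_eq_square)
qed

text \<open>A jump by \<open>t\<close> is a fixed chain of generator steps, so its energy is
  controlled with a constant depending on \<open>t\<close> only. This serves the edges of the tree,
  which are longer than edges of the graph.\<close>

lemma dirichlet_le_translate:
  assumes "t \<in> carrier G"
  shows "\<exists>\<kappa>\<ge>0. \<forall>f D U. dirichlet_le f D \<and> finite U \<and> U \<subseteq> Y \<longrightarrow>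
    (\<Sum>C\<in>U. (f C - f (C #> t))\<^sup>2) \<le> \<kappa> * D"
proof -
  have step: "(\<Sum>C\<in>U. (f C - f (C #> gs s))\<^sup>2) \<le> D"
    if "s \<in> steps" "dirichlet_le f D" "finite U" "U \<subseteq> Y" for s f D U
  proof -
    have "(\<Sum>C\<in>U. (f C - f (C #> gs s))\<^sup>2) \<le> (\<Sum>C\<in>U. \<Sum>s\<in>steps. (f C - f (C #> gs s))\<^sup>2)"
      using that finite_steps
      by (intro sum_mono member_le_sum[of s steps "\<lambda>s. (f C - f (C #> gs s))\<^sup>2" for C]) auto
    then show ?thesis using that unfolding dirichlet_le_def by force
  qed
  have "t \<in> generate G (\<pi> ` A)" using assms marking_generates by simp
  then show ?thesis
  proof (induction rule: generate.induct)
    case one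
    have "(\<Sum>C\<in>U. (f C - f (C #> \<one>))\<^sup>2) = 0" if "U \<subseteq> Y" for U and f :: "'a set \<Rightarrow> real"
      using that Y_mult_one by (intro sum.neutral) auto
    then show ?case by (intro exI[of _ 0]) auto
  next
    case (incl h)
    then obtain a where "a \<in> A" "h = gs (a, True)" by (auto simp: gen_step_def)
    then show ?case using step[of "(a, True)"] by (intro exI[of _ 1]) auto
  next
    case (inv h)
    then obtain a where "a \<in> A" "inv h = gs (a, False)" by (auto simp: gen_step_def)
    then show ?case using step[of "(a, False)"] by (intro exI[of _ 1]) auto
  next
    case (eng h1 h2)
    have hc: "h1 \<in> carrier G" "h2 \<in> carrier G" using eng marking_generates by auto
    from eng.IH(1) obtain k1 where k1: "0 \<le> k1"
      "\<And>f D U. \<lbrakk>dirichlet_le f D; finite U; U \<subseteq> Y\<rbrakk> \<Longrightarrow> (\<Sum>C\<in>U. (f C - f (C #> h1))\<^sup>2) \<le> k1 * D"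
      by blast
    from eng.IH(2) obtain k2 where k2: "0 \<le> k2"
      "\<And>f D U. \<lbrakk>dirichlet_le f D; finite U; U \<subseteq> Y\<rbrakk> \<Longrightarrow> (\<Sum>C\<in>U. (f C - f (C #> h2))\<^sup>2) \<le> k2 * D"
      by blast
    have "(\<Sum>C\<in>U. (f C - f (C #> (h1 \<otimes> h2)))\<^sup>2) \<le> (2 * k1 + 2 * k2) * D"
      if f: "dirichlet_le f D" and U: "finite U" "U \<subseteq> Y" for f D U
    proof -
      \<comment> \<open>The second half of each jump starts in the translate of \<open>U\<close> by
        \<open>h1\<close>, again a finite set of distinct cosets.\<close>
      let ?T = "(\<lambda>C. C #> h1) ` U"
      have T: "finite ?T" "?T \<subseteq> Y" using U Y_mult_closed hc by auto
      have "(\<Sum>C\<in>U. (f C - f (C #> (h1 \<otimes> h2)))\<^sup>2)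
          \<le> (\<Sum>C\<in>U. 2 * (f C - f (C #> h1))\<^sup>2 + 2 * (f (C #> h1) - f ((C #> h1) #> h2))\<^sup>2)"
      proof (rule sum_mono)
        fix C assume "C \<in> U"
        then have "(C #> h1) #> h2 = C #> (h1 \<otimes> h2)" using U hc Y_mult_assoc by blast
        moreover have "(a - c)\<^sup>2 \<le> 2 * (a - b)\<^sup>2 + 2 * (b - c)\<^sup>2" for a b c :: real
          using zero_le_power2[of "a - 2 * b + c"] by (simp add: power2_eq_square algebra_simps)
        ultimately show "(f C - f (C #> (h1 \<otimes> h2)))\<^sup>2
            \<le> 2 * (f C - f (C #> h1))\<^sup>2 + 2 * (f (C #> h1) - f ((C #> h1) #> h2))\<^sup>2" by simp
      qed
      also have "\<dots> = 2 * (\<Sum>C\<in>U. (f C - f (C #> h1))\<^sup>2) + 2 * (\<Sum>C\<in>?T. (f C - f (C #> h2))\<^sup>2)"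
        using inj_on_subset[OF Y_mult_inj[OF hc(1)] U(2)]
        by (simp add: sum.distrib sum_distrib_left sum.reindex)
      also have "\<dots> \<le> 2 * (k1 * D) + 2 * (k2 * D)" using k1(2)[OF f U] k2(2)[OF f T] by simp
      finally show ?thesis by (simp add: algebra_simps)
    qed
    then show ?case using k1(1) k2(1) by (intro exI[of _ "2 * k1 + 2 * k2"]) auto
  qed
qed

end

section \<open>Functions along a binary tree\<close>

lemma finite_bool_lists: "finite {w :: bool list. length w = n}"
  using finite_lists_length_eq[of "UNIV :: bool set" n] by simp

lemma card_bool_lists: "card {w :: bool list. length w = n} = 2 ^ n"
  using card_lists_length_eq[of "UNIV :: bool set" n] by simp

lemma sum_bool_lists_Suc:
  fixes \<phi> :: "bool list \<Rightarrow> real"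
  shows "(\<Sum>w | length w = Suc n. \<phi> w)
    = (\<Sum>w | length w = n. \<phi> (w @ [True])) + (\<Sum>w | length w = n. \<phi> (w @ [False]))"
proof -
  let ?W = "{w :: bool list. length w = n}" and ?e = "\<lambda>b w :: bool list. w @ [b]"
  have "w \<in> ?e True ` ?W \<union> ?e False ` ?W" if w: "length w = Suc n" for w
  proof -
    obtain v b where "w = v @ [b]" using w by (cases w rule: rev_cases) auto
    then show ?thesis using w by (cases b) auto
  qed
  then have "{w. length w = Suc n} = ?e True ` ?W \<union> ?e False ` ?W" by auto
  moreover have "sum \<phi> (?e True ` ?W \<union> ?e False ` ?W) = sum \<phi> (?e True ` ?W) + sum \<phi> (?e False ` ?W)"
    using finite_bool_lists by (intro sum.union_disjoint) auto
  moreover have "sum \<phi> (?e b ` ?W) = (\<Sum>w\<in>?W. \<phi> (w @ [b]))" for b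
    by (subst sum.reindex) (auto simp: inj_on_def)
  ultimately show ?thesis by simp
qed

lemma sum_le_fibre_bound:
  fixes \<phi> :: "'c \<Rightarrow> real"
  assumes S: "finite S" and fib: "\<And>y. card {x \<in> S. f x = y} \<le> M" and pos: "\<And>y. 0 \<le> \<phi> y"
  shows "(\<Sum>x\<in>S. \<phi> (f x)) \<le> real M * (\<Sum>y\<in>f ` S. \<phi> y)"
proof -
  have "(\<Sum>x\<in>S. \<phi> (f x)) = (\<Sum>y\<in>f ` S. \<Sum>x\<in>{x \<in> S. f x = y}. \<phi> (f x))"
    by (rule sum.image_gen[OF S])
  also have "\<dots> = (\<Sum>y\<in>f ` S. real (card {x \<in> S. f x = y}) * \<phi> y)"
    by (intro sum.cong) auto
  also have "\<dots> \<le> (\<Sum>y\<in>f ` S. real M * \<phi> y)"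
    using fib pos by (intro sum_mono mult_right_mono) auto
  finally show ?thesis by (simp add: sum_distrib_left)
qed

context coset_walk
begin

text \<open>Follow the average \<open>a n\<close> of \<open>f\<close> over level \<open>n\<close>:
  successive averages differ by at most \<open>B * sqrt D * q ^ n\<close>, and \<open>a n\<close>
  tends to 0 since finite support and bounded fibres leave boundedly many nonzero terms among
  \<open>2 ^ n\<close>. Telescoping bounds the value at the root.\<close>

lemma tree_value_bound:
  fixes z :: "bool list \<Rightarrow> 'a"
  assumes z: "range z \<subseteq> carrier G" and E: "range E \<subseteq> carrier G"
    and zE: "\<And>w b. z (w @ [b]) = z w \<otimes> E b"
    and fib: "\<And>n C. card {w \<in> {w. length w = n}. H #> z w = C} \<le> M"
  shows "\<exists>K\<ge>0. \<forall>f D. dirichlet_le f D \<and> finite {C \<in> Y. f C \<noteq> 0} \<longrightarrow> \<bar>f (H #> z [])\<bar> \<le> K * sqrt D"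
proof -
  have "\<forall>b. \<exists>\<kappa>\<ge>0. \<forall>f D U. dirichlet_le f D \<and> finite U \<and> U \<subseteq> Y \<longrightarrow>
      (\<Sum>C\<in>U. (f C - f (C #> E b))\<^sup>2) \<le> \<kappa> * D"
    using dirichlet_le_translate E by blast
  then obtain \<kappa> where k: "\<And>b. 0 \<le> \<kappa> b" and \<kappa>: "\<And>b f D U. dirichlet_le f D \<Longrightarrow> finite U \<Longrightarrow> U \<subseteq> Y \<Longrightarrow>
      (\<Sum>C\<in>U. (f C - f (C #> E b))\<^sup>2) \<le> \<kappa> b * D"
    by metis
  \<comment> \<open>\<open>q ^ n\<close> is \<open>sqrt (2 ^ n) / 2 ^ n\<close>: Cauchy-Schwarz
    costs the square root of the number of words, the average divides by that number.\<close>
  define q where "q = 1 / sqrt 2"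
  have q: "0 < q" "q < 1" by (auto simp: q_def)
  define B where "B = (sqrt (real M * \<kappa> True) + sqrt (real M * \<kappa> False)) / 2"
  have B: "0 \<le> B" using k by (simp add: B_def)
  have "\<bar>f (H #> z [])\<bar> \<le> B / (1 - q) * sqrt D"
    if f: "dirichlet_le f D" and fin: "finite {C \<in> Y. f C \<noteq> 0}" for f D
  proof -
    let ?W = "\<lambda>n. {w :: bool list. length w = n}"
    have D: "0 \<le> D" using f unfolding dirichlet_le_def by (force dest: spec[of _ "{}"])
    define v where "v w = H #> z w" for w
    have vY: "v w \<in> Y" for w using z coset_in_Y by (auto simp: v_def)
    have vE: "v (w @ [b]) = v w #> E b" for w b
      using z E zE coset_mult_assoc[OF H_subset] by (auto simp: v_def image_subset_iff)
    define a where "a n = (\<Sum>w\<in>?W n. f (v w)) / 2 ^ n" for n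
    have diff: "(\<Sum>w\<in>?W n. \<bar>f (v w) - f (v (w @ [b]))\<bar>) \<le> sqrt (2 ^ n) * (sqrt (real M * \<kappa> b) * sqrt D)" for n b
    proof -
      have "(\<Sum>w\<in>?W n. \<bar>f (v w) - f (v (w @ [b]))\<bar>)\<^sup>2
          \<le> real (card (?W n)) * (\<Sum>w\<in>?W n. \<bar>f (v w) - f (v (w @ [b]))\<bar>\<^sup>2)"
        using sum_squared_le_sum_of_squares[of "\<lambda>w. \<bar>f (v w) - f (v (w @ [b]))\<bar>" "?W n"]
        by (simp add: mult.commute)
      also have "\<dots> = 2 ^ n * (\<Sum>w\<in>?W n. (f (v w) - f (v w #> E b))\<^sup>2)"
        by (simp add: card_bool_lists vE)
      also have "(\<Sum>w\<in>?W n. (f (v w) - f (v w #> E b))\<^sup>2)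
          \<le> real M * (\<Sum>C\<in>v ` ?W n. (f C - f (C #> E b))\<^sup>2)"
        using fib[of n] finite_bool_lists by (intro sum_le_fibre_bound) (auto simp: v_def)
      also have "(\<Sum>C\<in>v ` ?W n. (f C - f (C #> E b))\<^sup>2) \<le> \<kappa> b * D"
        using f vY finite_bool_lists by (intro \<kappa>) auto
      finally have "(\<Sum>w\<in>?W n. \<bar>f (v w) - f (v (w @ [b]))\<bar>)\<^sup>2 \<le> 2 ^ n * (real M * (\<kappa> b * D))"
        by (simp add: mult_left_mono)
      then show ?thesis
        by (simp add: real_le_rsqrt real_sqrt_mult[symmetric] mult.assoc)
    qed
    have step: "\<bar>a n\<bar> \<le> \<bar>a (Suc n)\<bar> + B * sqrt D * q ^ n" for n
    proof -
      \<comment> \<open>Each word has two children, so \<open>a n\<close> is also an average with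
        weights \<open>1 / 2 ^ Suc n\<close> over the edges leaving level \<open>n\<close>.\<close>
      have "a n - a (Suc n) = (\<Sum>b\<in>{True, False}. \<Sum>w\<in>?W n. f (v w) - f (v (w @ [b]))) / 2 ^ Suc n"
        by (simp add: a_def sum_bool_lists_Suc sum_subtractf field_simps)
      then have "\<bar>a n - a (Suc n)\<bar> \<le> (\<Sum>b\<in>{True, False}. \<Sum>w\<in>?W n. \<bar>f (v w) - f (v (w @ [b]))\<bar>) / 2 ^ Suc n"
        by (simp only: abs_divide) (intro divide_mono order_trans[OF sum_abs] sum_mono sum_abs; simp)
      also have "\<dots> \<le> (\<Sum>b\<in>{True, False}. sqrt (2 ^ n) * (sqrt (real M * \<kappa> b) * sqrt D)) / 2 ^ Suc n"
        using diff by (intro divide_right_mono sum_mono) auto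
      also have "\<dots> = B * sqrt D * (sqrt (2 ^ n) / 2 ^ n)" by (simp add: B_def field_simps)
      also have "sqrt (2 ^ n) / 2 ^ n = q ^ n"
      proof -
        have "(2::real) ^ n = sqrt (2 ^ n) * sqrt (2 ^ n)" by simp
        then show ?thesis by (simp add: q_def real_sqrt_power power_one_over field_simps)
      qed
      finally show ?thesis by linarith
    qed
    have tele: "\<bar>a 0\<bar> \<le> \<bar>a n\<bar> + B * sqrt D * (\<Sum>k<n. q ^ k)" for n
    proof (induction n)
      case (Suc n)
      then show ?case using step[of n] by (simp add: distrib_left)
    qed simp
    have geo: "(\<Sum>k<n. q ^ k) \<le> 1 / (1 - q)" for n
      using q sum_le_suminf[OF summable_geometric, of q "{..<n}"] suminf_geometric[of q] by simp
    \<comment> \<open>At most \<open>M\<close> words of a level land on the same coset, so this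
      bounds the sum of \<open>f\<close> over every level.\<close>
    define T where "T = real M * (\<Sum>C | C \<in> Y \<and> f C \<noteq> 0. \<bar>f C\<bar>)"
    have small: "\<bar>a n\<bar> \<le> T * (1 / 2) ^ n" for n
    proof -
      have "\<bar>\<Sum>w\<in>?W n. f (v w)\<bar> \<le> (\<Sum>w\<in>?W n. \<bar>f (v w)\<bar>)" by (rule sum_abs)
      also have "\<dots> \<le> real M * (\<Sum>C\<in>v ` ?W n. \<bar>f C\<bar>)"
        using fib[of n] finite_bool_lists by (intro sum_le_fibre_bound) (auto simp: v_def)
      also have "(\<Sum>C\<in>v ` ?W n. \<bar>f C\<bar>) \<le> (\<Sum>C\<in>v ` ?W n \<union> {C. C \<in> Y \<and> f C \<noteq> 0}. \<bar>f C\<bar>)"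
        using fin finite_bool_lists by (intro sum_mono2) auto
      also have "\<dots> = (\<Sum>C | C \<in> Y \<and> f C \<noteq> 0. \<bar>f C\<bar>)"
        using fin finite_bool_lists vY by (intro sum.mono_neutral_right) auto
      finally have "\<bar>\<Sum>w\<in>?W n. f (v w)\<bar> \<le> T" by (simp add: T_def mult_left_mono)
      then show ?thesis by (simp add: a_def power_one_over divide_right_mono)
    qed
    have bound: "\<bar>a 0\<bar> - B * sqrt D * (1 / (1 - q)) \<le> T * (1 / 2) ^ n" for n
    proof -
      have "B * sqrt D * (\<Sum>k<n. q ^ k) \<le> B * sqrt D * (1 / (1 - q))"
        using geo B D by (intro mult_left_mono) auto
      then show ?thesis using tele[of n] small[of n] by linarith
    qed
    have "(\<lambda>n. T * (1 / 2) ^ n) \<longlonglongrightarrow> T * 0"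
      by (intro tendsto_mult_left LIMSEQ_realpow_zero) auto
    then have "\<bar>a 0\<bar> - B * sqrt D * (1 / (1 - q)) \<le> T * 0"
      by (rule LIMSEQ_le_const) (use bound in auto)
    moreover have "a 0 = f (H #> z [])" by (simp add: a_def v_def)
    ultimately show ?thesis by simp
  qed
  moreover have "0 \<le> B / (1 - q)" using B q by simp
  ultimately show ?thesis by blast
qed

text \<open>For the truncated Green function \<open>f\<close>, the energy is at most a multiple of
  \<open>f H\<close>, while the tree bounds \<open>f H\<close> by a multiple of the square root of
  the energy. Together they bound \<open>f H\<close> independently of \<open>N\<close>.\<close>

lemma return_prob_summable:
  fixes z :: "bool list \<Rightarrow> 'a"
  assumes z: "range z \<subseteq> carrier G" and E: "range E \<subseteq> carrier G"
    and zE: "\<And>w b. z (w @ [b]) = z w \<otimes> E b"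
    and fib: "\<And>n C. card {w \<in> {w. length w = n}. H #> z w = C} \<le> M"
  shows "summable (\<lambda>n. return_prob n H)"
proof -
  obtain K where K: "0 \<le> K" "\<And>f D. \<lbrakk>dirichlet_le f D; finite {C \<in> Y. f C \<noteq> 0}\<rbrakk> \<Longrightarrow>
      \<bar>f (H #> z [])\<bar> \<le> K * sqrt D"
    using tree_value_bound[OF z E zE fib] by blast
  \<comment> \<open>The root of the tree is \<open>H #> z []\<close>; this constant pays for the
    passage from there to \<open>H\<close>.\<close>
  obtain \<kappa> where \<kappa>: "0 \<le> \<kappa>" "\<And>f D U. \<lbrakk>dirichlet_le f D; finite U; U \<subseteq> Y\<rbrakk> \<Longrightarrow>
      (\<Sum>C\<in>U. (f C - f (C #> z []))\<^sup>2) \<le> \<kappa> * D"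
    using dirichlet_le_translate[of "z []"] z by blast
  let ?d = "4 * real (card A)"
  define Q where "Q = (K + sqrt \<kappa>) * sqrt ?d"
  have "(\<Sum>n<N. return_prob n H) \<le> Q\<^sup>2" for N
  proof -
    define f where "f C = (\<Sum>n<N. return_prob n C)" for C
    have f0: "0 \<le> f C" if "C \<in> Y" for C using that return_prob_nonneg by (auto simp: f_def intro: sum_nonneg)
    define V where "V = {C \<in> Y. f C \<noteq> 0}"
    have "V \<subseteq> (\<Union>n<N. {C \<in> Y. return_prob n C \<noteq> 0})"
      unfolding V_def f_def by (auto intro: ccontr sum.neutral)
    then have V: "finite V" "V \<subseteq> Y"
      using finite_subset[OF _ finite_UN_I[OF finite_lessThan return_prob_finite_support]]
      by (auto simp: V_def)
    \<comment> \<open>The sum telescopes: \<open>f\<close> has Laplacian the point mass at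
      \<open>H\<close>, up to the last term, which only lowers the energy.\<close>
    have "f C - avg f C = return_prob 0 C - return_prob N C" for C
    proof -
      have "avg f C = (\<Sum>n<N. return_prob (Suc n) C)"
        unfolding f_def return_prob_Suc by (rule avg_sum)
      then have "avg f C - f C = return_prob N C - return_prob 0 C"
        unfolding f_def using sum_lessThan_telescope[of "\<lambda>n. return_prob n C" N]
        by (simp add: sum_subtractf)
      then show ?thesis by linarith
    qed
    then have "(\<Sum>C\<in>V. f C * (f C - avg f C)) \<le> (\<Sum>C\<in>V. f C * return_prob 0 C)"
      using V f0 return_prob_nonneg by (intro sum_mono mult_left_mono) auto
    also have "\<dots> = (\<Sum>C\<in>V. if C = H then f C else 0)"
      by (intro sum.cong) (auto simp: return_prob_0)
    also have "\<dots> \<le> f H" using V f0 H_in_Y by (simp add: sum.delta)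
    finally have "(\<Sum>C\<in>V. f C * (f C - avg f C)) \<le> f H" .
    then have "?d * (\<Sum>C\<in>V. f C * (f C - avg f C)) \<le> ?d * f H" by (intro mult_left_mono) auto
    moreover have "dirichlet_le f (?d * (\<Sum>C\<in>V. f C * (f C - avg f C)))"
      using V by (intro dirichlet_le_energy) (auto simp: V_def)
    ultimately have D: "dirichlet_le f (?d * f H)" unfolding dirichlet_le_def by (meson order_trans)
    have "(f H - f (H #> z []))\<^sup>2 \<le> \<kappa> * (?d * f H)" using \<kappa>(2)[OF D, of "{H}"] H_in_Y by simp
    then have "\<bar>f H - f (H #> z [])\<bar> \<le> sqrt (\<kappa> * (?d * f H))" by (intro real_le_rsqrt) simp
    moreover have "\<bar>f (H #> z [])\<bar> \<le> K * sqrt (?d * f H)" using K(2)[OF D] V by (simp add: V_def)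
    ultimately have "f H \<le> K * sqrt (?d * f H) + sqrt (\<kappa> * (?d * f H))" by linarith
    also have "\<dots> = Q * sqrt (f H)" by (simp add: Q_def real_sqrt_mult algebra_simps)
    finally have le: "f H \<le> Q * sqrt (f H)" .
    have fH: "0 \<le> f H" using f0 H_in_Y by simp
    have "f H \<le> Q\<^sup>2"
    proof (cases "f H = 0")
      case False
      then have p: "0 < sqrt (f H)" using fH by simp
      have "sqrt (f H) * sqrt (f H) \<le> Q * sqrt (f H)" using le fH by simp
      then have "sqrt (f H) \<le> Q" using p mult_right_le_imp_le by blast
      then show ?thesis using sqrt_le_D by blast
    qed simp
    then show ?thesis by (simp add: f_def)
  qed
  then show ?thesis using return_prob_nonneg H_in_Y
    by (intro summableI_nonneg_bounded[of _ "Q\<^sup>2"]) auto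
qed

section \<open>First hits, renewal and recurrence\<close>

lemma first_hit_H: "first_hit G \<pi> A H n H = of_bool (n = 0)"
  by (cases n) auto

lemma first_hit_Suc: "C \<noteq> H \<Longrightarrow> first_hit G \<pi> A H (Suc n) C = avg (first_hit G \<pi> A H n) C"
  by (simp add: avg_def)

lemma first_return_avg: "first_return G \<pi> A H n = avg (first_hit G \<pi> A H n) H"
  by (simp add: first_return_def avg_def)

lemma first_hit_nonneg: "0 \<le> first_hit G \<pi> A H n C"
  by (induction n arbitrary: C) (auto intro!: divide_nonneg_nonneg sum_nonneg)

text \<open>Split at the time \<open>k\<close> of the first visit to \<open>H\<close>, by induction
  over the first step of the walk.\<close>

lemma return_prob_decompose:
  "C \<in> Y \<Longrightarrow> return_prob n C = (\<Sum>k\<le>n. first_hit G \<pi> A H k C * return_prob (n - k) H)"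
proof (induction n arbitrary: C)
  case 0
  show ?case by (simp add: return_prob_0)
next
  case (Suc n)
  show ?case
  proof (cases "C = H")
    case True
    have "(\<Sum>k\<le>Suc n. of_bool (k = 0) * return_prob (Suc n - k) H) = return_prob (Suc n) H"
      by (simp add: sum.atMost_Suc_shift del: sum.atMost_Suc)
    then show ?thesis unfolding True first_hit_H by simp
  next
    case False
    have "return_prob (Suc n) C = avg (\<lambda>C. \<Sum>k\<le>n. first_hit G \<pi> A H k C * return_prob (n - k) H) C"
      unfolding return_prob_Suc using Suc by (intro avg_cong) auto
    also have "\<dots> = (\<Sum>k\<le>n. avg (first_hit G \<pi> A H k) C * return_prob (n - k) H)"
      by (simp only: avg_sum avg_mult_right)
    also have "\<dots> = (\<Sum>k\<le>n. first_hit G \<pi> A H (Suc k) C * return_prob (n - k) H)"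
      using False by (simp only: first_hit_Suc not_False_eq_True)
    finally show ?thesis using False
      by (simp add: sum.atMost_Suc_shift del: sum.atMost_Suc first_hit.simps(2))
  qed
qed

text \<open>\<open>first_return\<close> at \<open>k\<close> concerns time \<open>k + 1\<close>,
  which leaves \<open>n - k\<close> of the \<open>Suc n\<close> steps.\<close>

lemma return_prob_renewal:
  "return_prob (Suc n) H = (\<Sum>k\<le>n. first_return G \<pi> A H k * return_prob (n - k) H)"
proof -
  have "return_prob (Suc n) H = avg (\<lambda>C. \<Sum>k\<le>n. first_hit G \<pi> A H k C * return_prob (n - k) H) H"
    unfolding return_prob_Suc using return_prob_decompose H_in_Y by (intro avg_cong) auto
  then show ?thesis by (simp only: avg_sum avg_mult_right first_return_avg)
qed

text \<open>If the first returns had total mass 1, the renewal equation would give the return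
  probabilities from time 1 on the same sum as those from time 0 on; but the term at time 0 is
  1.\<close>

lemma transient_if_summable:
  assumes "summable (\<lambda>n. return_prob n H)"
  shows "srw_transient G \<pi> A H"
  unfolding srw_transient_def srw_recurrent_def
proof
  assume F: "first_return G \<pi> A H sums 1"
  let ?p = "\<lambda>n. return_prob n H"
  have F0: "0 \<le> first_return G \<pi> A H n" for n
    unfolding first_return_avg using H_in_Y first_hit_nonneg by (intro avg_nonneg) auto
  have "(\<lambda>k. \<Sum>i\<le>k. first_return G \<pi> A H i * ?p (k - i)) sums
      (suminf (first_return G \<pi> A H) * suminf ?p)"
    using assms F F0 return_prob_nonneg[OF H_in_Y] by (intro Cauchy_product_sums) (auto simp: sums_iff)
  then have "(\<lambda>n. ?p (Suc n)) sums suminf ?p"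
    using F by (simp add: return_prob_renewal sums_iff)
  then have "suminf (\<lambda>n. ?p (Suc n)) = suminf ?p" by (simp add: sums_iff)
  then show False using suminf_split_head[OF assms] by (simp add: return_prob_0)
qed

lemma first_hit_partial_sum_le: "C \<in> Y \<Longrightarrow> (\<Sum>k\<le>n. first_hit G \<pi> A H k C) \<le> 1"
proof (induction n arbitrary: C)
  case (Suc n)
  show ?case
  proof (cases "C = H")
    case True
    then show ?thesis by (simp add: first_hit_H sum.atMost_Suc_shift del: sum.atMost_Suc first_hit.simps)
  next
    case False
    have "(\<Sum>k\<le>Suc n. first_hit G \<pi> A H k C) = (\<Sum>k\<le>n. first_hit G \<pi> A H (Suc k) C)"
      using False by (simp add: sum.atMost_Suc_shift del: sum.atMost_Suc first_hit.simps(2))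
    also have "\<dots> = avg (\<lambda>C. \<Sum>k\<le>n. first_hit G \<pi> A H k C) C"
      using False by (simp only: first_hit_Suc avg_sum not_False_eq_True)
    also have "\<dots> \<le> 1"
    proof -
      have "0 \<le> avg (\<lambda>C. 1 - (\<Sum>k\<le>n. first_hit G \<pi> A H k C)) C"
        using Suc by (intro avg_nonneg) auto
      also have "\<dots> = avg (\<lambda>_. 1) C - avg (\<lambda>C. \<Sum>k\<le>n. first_hit G \<pi> A H k C) C"
        by (simp add: avg_def sum_subtractf diff_divide_distrib)
      finally show ?thesis by (simp add: avg_const)
    qed
    finally show ?thesis .
  qed
qed simp

lemma sums_avg:
  assumes "C \<in> Y" "\<And>C. C \<in> Y \<Longrightarrow> (\<lambda>n. f n C) sums s C"
  shows "(\<lambda>n. avg (f n) C) sums avg s C"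
  unfolding avg_def using assms Y_mult_closed gs_closed
  by (intro sums_divide sums_sum) auto

lemma recurrent_if_finite:
  assumes fin: "finite Y"
  shows "srw_recurrent G \<pi> A H"
proof -
  let ?h = "first_hit G \<pi> A H"
  \<comment> \<open>The probability of never hitting \<open>H\<close> from \<open>C\<close>.\<close>
  define r where "r C = 1 - suminf (\<lambda>n. ?h n C)" for C
  have bound: "(\<Sum>k<n. ?h k C) \<le> 1" if "C \<in> Y" for C n
    using sum_mono2[of "{..n}" "{..<n}" "\<lambda>k. ?h k C"] first_hit_nonneg
      first_hit_partial_sum_le[OF that, of n] by force
  then have sm: "summable (\<lambda>n. ?h n C)" if "C \<in> Y" for C
    using that first_hit_nonneg by (intro summableI_nonneg_bounded[of _ 1]) auto
  then have sums: "(\<lambda>n. ?h n C) sums (1 - r C)" if "C \<in> Y" for C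
    using that by (simp add: r_def summable_sums)
  have rH: "r H = 0"
    using suminf_finite[of "{0}" "\<lambda>n. ?h n H"] by (simp add: r_def first_hit_H del: first_hit.simps)
  have avg_minus: "avg (\<lambda>C. 1 - r C) C = 1 - avg r C" for C
    using avg_const[of 1 C] by (simp add: avg_def sum_subtractf diff_divide_distrib)
  have harm: "r C = avg r C" if C: "C \<in> Y" "C \<noteq> H" for C
  proof -
    have "(\<lambda>n. avg (?h n) C) sums avg (\<lambda>C. 1 - r C) C" by (intro sums_avg C sums)
    then have "(\<lambda>n. ?h (Suc n) C) sums (1 - avg r C)" using C by (simp only: first_hit_Suc avg_minus not_False_eq_True)
    moreover have "(\<lambda>n. ?h (Suc n) C) sums (1 - r C - ?h 0 C)" using sums[OF C(1)] by (subst sums_Suc_iff) simp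
    ultimately have "1 - avg r C = 1 - r C - ?h 0 C" by (rule sums_unique2)
    then show ?thesis using C by simp
  qed
  have r0: "0 \<le> r C" if "C \<in> Y" for C
    using suminf_le_const[OF sm[OF that] bound[OF that]] by (simp add: r_def)
  define m where "m = Max (r ` Y)"
  have rm: "r C \<le> m" if "C \<in> Y" for C using that fin by (simp add: m_def)
  have "m \<in> r ` Y" unfolding m_def using fin H_in_Y by (intro Max_in) auto
  then obtain C0 where C0: "C0 \<in> Y" "r C0 = m" by auto
  have "m = 0"
  proof (rule ccontr)
    assume m: "m \<noteq> 0"
    \<comment> \<open>At a maximum away from \<open>H\<close>, harmonicity makes \<open>m\<close> an
      average of values at most \<open>m\<close>, so all of them equal \<open>m\<close>.\<close>
    have step: "r (C #> gs s) = m" if C: "C \<in> Y" "r C = m" and s: "s \<in> steps" for C s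
    proof -
      have "C \<noteq> H" using C m rH by auto
      then have "avg r C = m" using harm[OF C(1)] C(2) by metis
      then have "(\<Sum>s\<in>steps. r (C #> gs s)) = (\<Sum>s\<in>steps. m)"
        using card_steps by (simp add: avg_def field_simps)
      then have "(\<Sum>s\<in>steps. m - r (C #> gs s)) = 0" by (simp add: sum_subtractf)
      moreover have "0 \<le> m - r (C #> gs s)" if "s \<in> steps" for s
        using that rm C Y_mult_closed gs_closed by simp
      ultimately have "m - r (C #> gs s) = 0"
        using sum_nonneg_eq_0_iff[OF finite_steps, of "\<lambda>s. m - r (C #> gs s)"] s by blast
      then show ?thesis by simp
    qed
    \<comment> \<open>As the letters generate the group, the maximal value spreads from
      \<open>C0\<close> to every coset, in particular to \<open>H\<close>, where \<open>r\<close> is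
      0.\<close>
    have all: "\<forall>C\<in>Y. r C = m \<longrightarrow> r (C #> t) = m" if "t \<in> generate G (\<pi> ` A)" for t
      using that
    proof (induction rule: generate.induct)
      case one
      show ?case using Y_mult_one by simp
    next
      case (incl h)
      then obtain a where "a \<in> A" "h = gs (a, True)" by (auto simp: gen_step_def)
      then show ?case using step[of _ "(a, True)"] by auto
    next
      case (inv h)
      then obtain a where "a \<in> A" "inv h = gs (a, False)" by (auto simp: gen_step_def)
      then show ?case using step[of _ "(a, False)"] by auto
    next
      case (eng h1 h2)
      then have "h1 \<in> carrier G" "h2 \<in> carrier G" using marking_generates by auto
      then show ?case using eng.IH Y_mult_closed Y_mult_assoc by metis
    qed
    obtain x where x: "x \<in> carrier G" "C0 = H #> x" using C0 by (auto simp: RCOSETS_def)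
    then have "C0 #> inv x = H" using Y_mult_cancel H_in_Y by simp
    moreover have "r (C0 #> inv x) = m" using all[of "inv x"] x C0 marking_generates by simp
    ultimately show False using rH m by simp
  qed
  then have "r C = 0" if "C \<in> Y" for C using r0 rm that by force
  then have "(\<lambda>n. avg (?h n) H) sums avg (\<lambda>_. 1) H"
    using sums H_in_Y by (intro sums_avg) fastforce+
  moreover have "first_return G \<pi> A H = (\<lambda>n. avg (?h n) H)" by (rule ext) (rule first_return_avg)
  ultimately show ?thesis by (simp add: srw_recurrent_def avg_const)
qed

end

theorem theorem1p3:
  fixes G :: "('g, 'm) monoid_scheme" and \<pi> :: "'a \<Rightarrow> 'g" and A :: "'a set" and H :: "'g set"
  assumes "group G"
    and "finite A"
    and "\<pi> ` A \<subseteq> carrier G"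
    and "generate G (\<pi> ` A) = carrier G"
    and "torsion_free G"
    and "\<not> virtually_cyclic G"
    and "word_hyperbolic G \<pi> A"
    and "subgroup H G"
    and "quasiconvex G \<pi> A H"
  shows "srw_transient G \<pi> A H \<longleftrightarrow> infinite (rcosets\<^bsub>G\<^esub> H)"
proof -
  interpret group G by fact
  \<comment> \<open>Without letters the group is trivial, hence virtually cyclic. A letter is needed
    because \<open>avg\<close> divides by the number of steps.\<close>
  have "A \<noteq> {}"
  proof
    assume "A = {}"
    then have "carrier G = generate G {}" using assms(4) by simp
    then have "carrier G = {\<one>\<^bsub>G\<^esub>}" using generate_empty by simp
    then have "rcosets\<^bsub>G\<^esub> (generate G {\<one>\<^bsub>G\<^esub>}) \<subseteq> Pow {\<one>\<^bsub>G\<^esub>}"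
      using rcosets_subset_PowG[OF generate_is_subgroup, of "{\<one>\<^bsub>G\<^esub>}"] by simp
    then have "finite (rcosets\<^bsub>G\<^esub> (generate G {\<one>\<^bsub>G\<^esub>}))" by (rule finite_subset) simp
    then show False using assms(6) by (auto simp: virtually_cyclic_def)
  qed
  then interpret coset_walk G \<pi> A H
    by (intro coset_walk.intro marked_group.intro coset_walk_axioms.intro marked_group_axioms.intro assms)
  show ?thesis
  proof
    assume "srw_transient G \<pi> A H"
    then show "infinite (rcosets\<^bsub>G\<^esub> H)" using recurrent_if_finite by (auto simp: srw_transient_def)
  next
    assume inf: "infinite (rcosets\<^bsub>G\<^esub> H)"
    obtain \<delta> where hyp: "hyperbolic_length G wlen \<delta>" using hyperbolic_length_wlen assms by blast
    obtain K where K: "\<And>g h. \<lbrakk>g \<in> carrier G; \<forall>h\<in>H. wlen g \<le> wlen (h \<otimes>\<^bsub>G\<^esub> g); h \<in> H\<rbrakk> \<Longrightarrow>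
        hyperbolic_length.gp G wlen g h \<le> K"
      using quasiconvex_gp_bound[OF hyp assms(8,9)] by blast
    have "\<exists>z :: bool list \<Rightarrow> 'g. \<exists>E M. range z \<subseteq> carrier G \<and> range E \<subseteq> carrier G \<and>
        (\<forall>w b. z (w @ [b]) = z w \<otimes>\<^bsub>G\<^esub> E b) \<and>
        (\<forall>n C. card {w \<in> {w. length w = n}. H #>\<^bsub>G\<^esub> z w = C} \<le> M)"
      by (rule hyperbolic_length.exists_coset_tree[OF hyp assms(6,8) inf]) (rule K)
    then obtain z :: "bool list \<Rightarrow> 'g" and E M where "range z \<subseteq> carrier G" "range E \<subseteq> carrier G"
      "\<And>w b. z (w @ [b]) = z w \<otimes>\<^bsub>G\<^esub> E b"
      "\<And>n C. card {w \<in> {w. length w = n}. H #>\<^bsub>G\<^esub> z w = C} \<le> M" by blast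
    then have "summable (\<lambda>n. return_prob n H)" by (rule return_prob_summable)
    then show "srw_transient G \<pi> A H" by (rule transient_if_summable)
  qed
qed

end
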